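(* Consider the double-integrator network $$\begin{bmatrix}\dot{\mathbf x}\\ \dot{\mathbf v}\end{bmatrix}=\begin{bmatrix}0 & I\\ -k_p I-\gamma_p L & -k_d I-\gamma_d L\end{bmatrix}\begin{bmatrix}\mathbf x\\ \mathbf v\end{bmatrix}+\begin{bmatrix}0\\ I\end{bmatrix}\mathbf w$$ with zero initial condition, impulse input $\mathbf w(t)=\mathbf w_0\delta(t)$, $\mathbf w_0\in\mathbb R^n$, and output either $\mathbf y=C\mathbf x$ (position-based) or $\mathbf y=C\mathbf v$ (velocity-based). Suppose that $L$ is diagonalizable. Then the performance metric $P=\int_0^\infty\mathbf y(t)^*\mathbf y(t)\,dt$ is $$P=\operatorname{tr}(\Sigma_Q\Psi),\qquad\Sigma_Q=\tilde Q\,\mathbf w_0\mathbf w_0^*\,\tilde Q^*,$$ where $\Psi=[\Psi_{kl}]_{2\le k,l\le n}$ is the matrix defined in the context, whose diagonal entries are $$\Psi_{kk}=\nu_{kk}\frac{\phi_k}{2(\alpha_k\phi_k^2+\beta_k\xi_k\phi_k-\beta_k^2)}$$ for the position-based output, and $$\Psi_{kk}=\nu_{kk}\frac{\xi_k\beta_k+\phi_k\alpha_k}{2(\alpha_k\phi_k^2+\beta_k\xi_k\phi_k-\beta_k^2)}$$ for the velocity-based output, with $\alpha_k=k_p+\gamma_p\mathrm{Re}[\lambda_k]$, $\phi_k=k_d+\gamma_d\mathrm{Re}[\lambda_k]$, $\beta_k=\gamma_p\mathrm{Im}[\lambda_k]$, $\xi_k=\gamma_d\mathrm{Im}[\lambda_k]$.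 (The off-diagonal entries $\Psi_{kl}$, $k\ne l$, are not given in explicit form.)
   Context: $\mathcal G$ is a weighted directed graph on nodes $\{1,\dots,n\}$ without self-loops, with weights $b_{ij}>0$ if $(i,j)$ is an edge and $b_{ij}=0$ otherwise, having at least one globally reachable node (a node to which every other node has a directed path). $L$ is its weighted Laplacian: $[L]_{ii}=\sum_jb_{ij}$, $[L]_{ij}=-b_{ij}$ for $i\ne j$. The gains satisfy $k_p,k_d,\gamma_p,\gamma_d\ge0$, with at least one of $(k_p,\gamma_p)$ and at least one of $(k_d,\gamma_d)$ nonzero. The output matrix $C\in\mathbb R^{q\times n}$ satisfies $C\mathbf 1=\mathbf 0$, where $\mathbf 1$ is the all-ones vector. Since $L$ is diagonalizable, $L=R\,\mathrm{diag}(\lambda_1,\dots,\lambda_n)R^{-1}$ with $\lambda_1=0$ (and $\mathrm{Re}\,\lambda_k>0$ for $k\ge2$ because of the globally reachable node); $R$ has columns $\mathbf r_1=\alpha\mathbf 1$ (for a nonzero scalar $\alpha\in\mathbb C$), $\mathbf r_2,\dots,\mathbf r_n$, and $\tilde Q\in\mathbb C^{(n-1)\times n}$ consists of the last $n-1$ rows of $R^{-1}$. $M=C^*C$ has an orthonormal eigenbasis $\boldsymbol\theta_1=\mathbf 1/\sqrt n,\boldsymbol\theta_2,\dots,\boldsymbol\theta_n$ with eigenvalues $\mu_1=0,\mu_2,\dots,\mu_n$, and $\nu_{kl}=\sum_{i=2}^n(\mathbf r_k^*\boldsymbol\theta_i)(\boldsymbol\theta_i^*\mathbf r_l)\mu_i$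 for $k,l\in\{2,\dots,n\}$. $\Psi_{kl}=\nu_{kl}\int_0^\infty\overline{\tilde h^{(k)}(t)}\,\tilde h^{(l)}(t)\,dt$ for $k,l\in\{2,\dots,n\}$, where $\tilde h^{(k)}(t)$ is the inverse Laplace transform of $\frac{r(s)}{s^2+(k_d+\gamma_d\lambda_k)s+k_p+\gamma_p\lambda_k}$ with $r(s)=1$ for the position-based output and $r(s)=s$ for the velocity-based output.
   Formalization: The formal theorem additionally assumes that the integrals over [0,∞) defining the entries of Ψ converge absolutely; without this (unstable modes k ≥ 2, possible for complex λ_k with small damping) Ψ is undefined and the closed forms fail. *)

theory Defs
  imports "HOL-Probability.Probability" "Jordan_Normal_Form.Schur_Decomposition"
begin

text \<open>
  Vectors and matrices are those of Jordan_Normal_Form, so all indices start at 0: node \<open>i + 1\<close>, and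
  likewise the index \<open>i + 1\<close> of an eigenvalue or eigenvector, is represented by \<open>i\<close>.
\<close>

unbundle no vec_syntax

definition weighted_digraph :: "nat \<Rightarrow> (nat \<times> nat) set \<Rightarrow> (nat \<Rightarrow> nat \<Rightarrow> real) \<Rightarrow> bool" where
  "weighted_digraph n E b \<longleftrightarrow> E \<subseteq> {..<n} \<times> {..<n} \<and> irrefl E \<and>
     (\<forall>i<n. \<forall>j<n. ((i, j) \<in> E \<longrightarrow> b i j > 0) \<and> ((i, j) \<notin> E \<longrightarrow> b i j = 0))"

definition globally_reachable :: "nat \<Rightarrow> (nat \<times> nat) set \<Rightarrow> nat \<Rightarrow> bool" where
  "globally_reachable n E r \<longleftrightarrow> r < n \<and> (\<forall>i<n. (i, r) \<in> E\<^sup>*)"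

definition laplacian :: "nat \<Rightarrow> (nat \<Rightarrow> nat \<Rightarrow> real) \<Rightarrow> real mat" where
  "laplacian n b = Matrix.mat n n (\<lambda>(i, j). if i = j then (\<Sum>k<n. b i k) else - b i j)"

definition ones :: "nat \<Rightarrow> 'a::one vec" where
  "ones n = Matrix.vec n (\<lambda>_. 1)"

abbreviation cmat :: "real mat \<Rightarrow> complex mat" where
  "cmat \<equiv> map_mat complex_of_real"

abbreviation cvec :: "real vec \<Rightarrow> complex vec" where
  "cvec \<equiv> map_vec complex_of_real"

definition mat_trace :: "'a::comm_monoid_add mat \<Rightarrow> 'a" where
  "mat_trace A = (\<Sum>i<dim_row A. A $$ (i, i))"

text \<open>
  \<open>impulse_response A u X\<close>: the trajectory \<open>X\<close> solves \<open>X' = A X + u \<delta>\<close> on the whole time axis and vanishes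
  before time 0. As \<open>\<delta>\<close> is a measure (the Dirac measure at 0) and \<open>X\<close> jumps at 0, the equation is
  integrated over \<open>(s,t]\<close>, which makes \<open>X\<close> right-continuous.
\<close>

definition impulse_response :: "real mat \<Rightarrow> real vec \<Rightarrow> (real \<Rightarrow> real vec) \<Rightarrow> bool" where
  "impulse_response A u X \<longleftrightarrow>
     (\<forall>t. X t \<in> carrier_vec (dim_row A)) \<and>
     (\<forall>t<0. X t = 0\<^sub>v (dim_row A)) \<and>
     (\<forall>s t. s \<le> t \<longrightarrow> (\<forall>i<dim_row A.
        ((\<lambda>\<tau>. (A *\<^sub>v X \<tau>) $ i) has_integral
          (X t $ i - X s $ i - (LINT \<tau>:{s<..t}|return borel 0. u $ i))) {s..t}))"

definition system_mat :: "nat \<Rightarrow> real \<Rightarrow> real \<Rightarrow> real \<Rightarrow> real \<Rightarrow> real mat \<Rightarrow> real mat" where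
  "system_mat n k\<^sub>p k\<^sub>d \<gamma>\<^sub>p \<gamma>\<^sub>d L =
     four_block_mat (0\<^sub>m n n) (1\<^sub>m n)
       (- (k\<^sub>p \<cdot>\<^sub>m 1\<^sub>m n) - \<gamma>\<^sub>p \<cdot>\<^sub>m L) (- (k\<^sub>d \<cdot>\<^sub>m 1\<^sub>m n) - \<gamma>\<^sub>d \<cdot>\<^sub>m L)"

definition input_mat :: "nat \<Rightarrow> real mat" where
  "input_mat n = 0\<^sub>m n n @\<^sub>r 1\<^sub>m n"

datatype output_kind = Position | Velocity

definition network_output ::
    "output_kind \<Rightarrow> real mat \<Rightarrow> (real \<Rightarrow> real vec) \<Rightarrow> (real \<Rightarrow> real vec) \<Rightarrow> real \<Rightarrow> real vec" where
  "network_output out C x v t = (case out of Position \<Rightarrow> C *\<^sub>v x t | Velocity \<Rightarrow> C *\<^sub>v v t)"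

definition has_laplace_transform :: "(real \<Rightarrow> complex) \<Rightarrow> (complex \<Rightarrow> complex) \<Rightarrow> bool" where
  "has_laplace_transform h F \<longleftrightarrow> (\<exists>\<sigma>. \<forall>s. Re s > \<sigma> \<longrightarrow>
     set_integrable lborel {0..} (\<lambda>t. exp (- s * complex_of_real t) * h t) \<and>
     (LINT t:{0..}|lborel. exp (- s * complex_of_real t) * h t) = F s)"

text \<open>
  Continuity on \<open>[0,\<infinity>)\<close> and vanishing for negative times single out one representative of the inverse
  (one-sided) Laplace transform.
\<close>

definition inverse_laplace :: "(complex \<Rightarrow> complex) \<Rightarrow> real \<Rightarrow> complex" where
  "inverse_laplace F =
     (THE h. continuous_on {0..} h \<and> (\<forall>t<0. h t = 0) \<and> has_laplace_transform h F)"

definition output_poly :: "output_kind \<Rightarrow> complex \<Rightarrow> complex" where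
  "output_poly out s = (case out of Position \<Rightarrow> 1 | Velocity \<Rightarrow> s)"

definition modal_response ::
    "output_kind \<Rightarrow> real \<Rightarrow> real \<Rightarrow> real \<Rightarrow> real \<Rightarrow> complex \<Rightarrow> real \<Rightarrow> complex" where
  "modal_response out k\<^sub>p k\<^sub>d \<gamma>\<^sub>p \<gamma>\<^sub>d l =
     inverse_laplace (\<lambda>s. output_poly out s /
       (s\<^sup>2 + (of_real k\<^sub>d + of_real \<gamma>\<^sub>d * l) * s + of_real k\<^sub>p + of_real \<gamma>\<^sub>p * l))"

text \<open>
  The product \<open>x \<bullet>c y\<close> conjugates its second argument, so \<open>x \<bullet>c y\<close> is \<open>y\<^sup>* x\<close>.
\<close>

definition nu :: "nat \<Rightarrow> complex mat \<Rightarrow> (nat \<Rightarrow> complex vec) \<Rightarrow> (nat \<Rightarrow> real) \<Rightarrow> nat \<Rightarrow> nat \<Rightarrow> complex" where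
  "nu n R \<theta> \<mu> k l =
     (\<Sum>i=1..<n. (\<theta> i \<bullet>c col R k) * (col R l \<bullet>c \<theta> i) * complex_of_real (\<mu> i))"

definition Psi :: "nat \<Rightarrow> (nat \<Rightarrow> nat \<Rightarrow> complex) \<Rightarrow> (nat \<Rightarrow> real \<Rightarrow> complex) \<Rightarrow> complex mat" where
  "Psi n \<nu> h = Matrix.mat (n - 1) (n - 1)
     (\<lambda>(k, l). \<nu> (k + 1) (l + 1) * (LINT t:{0..}|lborel. cnj (h (k + 1) t) * h (l + 1) t))"

definition drop_first_row :: "'a mat \<Rightarrow> 'a mat" where
  "drop_first_row A = Matrix.mat (dim_row A - 1) (dim_col A) (\<lambda>(i, j). A $$ (i + 1, j))"

definition Sigma_Q :: "complex mat \<Rightarrow> complex vec \<Rightarrow> complex mat" where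
  "Sigma_Q Q w = (let W = mat_of_cols (dim_vec w) [w] in Q * (W * mat_adjoint W) * mat_adjoint Q)"

end

theory Submission
  imports Defs
begin

text \<open>
  In the coordinates \<open>R\<^sup>-\<^sup>1 x\<close> the network decouples into scalar equations \<open>z'' + p z' + c z = 0\<close> with
  \<open>p = k\<^sub>d + \<gamma>\<^sub>d \<lambda>\<close>, \<open>c = k\<^sub>p + \<gamma>\<^sub>p \<lambda>\<close>, \<open>z(0) = 0\<close> and \<open>z'(0)\<close> a coordinate of \<open>R\<^sup>-\<^sup>1 w\<^sub>0\<close>, so each coordinate is a
  multiple of the inverse Laplace transform in the definition of \<open>\<Psi>\<close>, which is unique by Lerch's theorem
  (obtained here from the uniqueness of characteristic functions). Expanding \<open>C\<^sup>* C\<close> in its eigenbasis turns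
  \<open>y\<^sup>* y\<close> into a double sum over modes, in which the mode along the all-ones vector is invisible, and
  integrating termwise gives the trace formula.

  For the diagonal entries, \<open>Re \<lambda> > 0\<close> by a maximum principle along the paths to the globally reachable
  node, hence \<open>Re p > 0\<close> and at least one of the two poles is stable; square integrability of the response
  forces the other one to be stable as well. A Hermitian form in \<open>(z, z')\<close> whose derivative is a multiple of
  \<open>\<bar>z\<bar>\<^sup>2\<close> (or of \<open>\<bar>z'\<bar>\<^sup>2\<close>) then evaluates the integral, and also shows that the denominators do not vanish.
\<close>

section \<open>Second-order modal responses\<close>

text \<open>Domination by a multiple of \<open>exp (- e * t)\<close>, whose antiderivative
  \<open>- exp (- e * t) / e\<close> tends to 0 at infinity, so that its integral is finite.\<close>

lemma set_integrable_exp_decay: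
  fixes f :: "real \<Rightarrow> complex"
  assumes cont: "continuous_on {0..} f" and e: "e > 0"
    and bound: "\<And>t. t \<ge> 0 \<Longrightarrow> norm (f t) \<le> K * exp (- e * t)"
  shows "set_integrable lborel {0..} f"
proof -
  have lim: "((\<lambda>t. - exp (- e * t) / e) \<longlongrightarrow> 0) at_top"
    using e by real_asymp
  have d: "((\<lambda>t. - exp (- e * t) / e) has_real_derivative exp (- e * t)) (at t)" for t
    using e by (auto intro!: derivative_eq_intros)
  have nn: "(\<integral>\<^sup>+x. ennreal (exp (- e * x)) * indicator {0..} x \<partial>lborel) = ennreal (1 / e)"
    using nn_integral_FTC_atLeast[OF _ d _ lim, of 0] by simp
  have int: "integrable lborel (\<lambda>t. indicat_real {0..} t * exp (- e * t))"
  proof (rule integrableI_nonneg)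
    have "(\<integral>\<^sup>+x. ennreal (indicat_real {0..} x * exp (- e * x)) \<partial>lborel)
       = (\<integral>\<^sup>+x. ennreal (exp (- e * x)) * indicator {0..} x \<partial>lborel)"
      by (intro nn_integral_cong) (auto simp: indicator_def)
    then show "(\<integral>\<^sup>+x. ennreal (indicat_real {0..} x * exp (- e * x)) \<partial>lborel) < \<infinity>"
      using nn by simp
  qed auto
  show ?thesis
    unfolding set_integrable_def
  proof (rule Bochner_Integration.integrable_bound)
    show "integrable lborel (\<lambda>t. K * (indicat_real {0..} t * exp (- e * t)))"
      using int by simp
    show "(\<lambda>x. indicat_real {0..} x *\<^sub>R f x) \<in> borel_measurable lborel"
      using borel_measurable_continuous_on_indicator[OF _ cont] by simp
    have K: "0 \<le> K" using bound[of 0] order_trans[OF norm_ge_zero[of "f 0"]] by simp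
    show "AE x in lborel. norm (indicat_real {0..} x *\<^sub>R f x)
        \<le> norm (K * (indicat_real {0..} x * exp (- e * x)))"
      using bound K by (auto simp: indicator_def abs_mult)
  qed
qed

text \<open>Integrability makes the integrals over \<open>{0..b}\<close> converge to the one over
  \<open>{0..}\<close>, while the fundamental theorem evaluates them as
  \<open>F b - F 0\<close>.\<close>

lemma set_integral_FTC_atLeast:
  fixes F f :: "real \<Rightarrow> complex"
  assumes d: "\<And>t. (F has_vector_derivative f t) (at t)"
    and cont: "continuous_on {0..} f"
    and int: "set_integrable lborel {0..} f" and lim: "(F \<longlongrightarrow> 0) at_top"
  shows "(LINT t:{0..}|lborel. f t) = - F 0"
proof -
  have "((\<lambda>b. LINT t:{0..b}|lborel. f t) \<longlongrightarrow> (LINT t:{0..}|lborel. f t)) at_top"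
    by (rule tendsto_set_lebesgue_integral_at_top) (auto intro: int)
  moreover have "\<forall>\<^sub>F b in at_top. F b - F 0 = (LINT t:{0..b}|lborel. f t)"
    using eventually_ge_at_top[of 0]
  proof eventually_elim
    case (elim b)
    show ?case unfolding set_lebesgue_integral_def
      by (rule integral_FTC_Icc[symmetric])
        (use elim d cont in \<open>auto intro: has_vector_derivative_at_within continuous_on_subset\<close>)
  qed
  then have "((\<lambda>b. LINT t:{0..b}|lborel. f t) \<longlongrightarrow> 0 - F 0) at_top"
    by (rule Lim_transform_eventually[rotated]) (intro tendsto_intros lim)
  ultimately show ?thesis
    using tendsto_unique[OF trivial_limit_at_top_linorder] by fastforce
qed

section \<open>Fundamental solutions and their Laplace transforms\<close>

text \<open>The solution of \<open>z'' - (s1 + s2) z' + s1 s2 z = 0\<close> with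
  \<open>z(0) = 0\<close> and \<open>z'(0) = 1\<close>: the divided difference of
  \<open>exp (s t)\<close> in \<open>s\<close>, with the confluent case for a double root.\<close>

definition modal_pos :: "complex \<Rightarrow> complex \<Rightarrow> real \<Rightarrow> complex" where
  "modal_pos s1 s2 t = (if s1 = s2 then of_real t * exp (s1 * of_real t)
     else (exp (s1 * of_real t) - exp (s2 * of_real t)) / (s1 - s2))"

text \<open>The derivative of \<open>modal_pos\<close>. The form
  \<open>z' = exp (s1 t) + s2 z\<close> covers distinct and double roots with one formula.\<close>

definition modal_vel :: "complex \<Rightarrow> complex \<Rightarrow> real \<Rightarrow> complex" where
  "modal_vel s1 s2 t = exp (s1 * of_real t) + s2 * modal_pos s1 s2 t"

definition modal_output :: "output_kind \<Rightarrow> complex \<Rightarrow> complex \<Rightarrow> real \<Rightarrow> complex" where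
  "modal_output out s1 s2 = (case out of Position \<Rightarrow> modal_pos s1 s2 | Velocity \<Rightarrow> modal_vel s1 s2)"

lemma modal_pos_vel_0 [simp]: "modal_pos s1 s2 0 = 0" "modal_vel s1 s2 0 = 1"
  by (simp_all add: modal_pos_def modal_vel_def)

lemma modal_pos_commute: "modal_pos s1 s2 = modal_pos s2 s1"
  by (auto simp: modal_pos_def fun_eq_iff divide_simps) (simp add: algebra_simps)

lemma modal_vel_commute: "modal_vel s1 s2 = modal_vel s2 s1"
proof
  show "modal_vel s1 s2 t = modal_vel s2 s1 t" for t
    by (cases "s1 = s2") (auto simp: modal_pos_def modal_vel_def divide_simps, simp add: algebra_simps)
qed

lemma has_vector_derivative_exp_of_real:
  "((\<lambda>t. exp (s * complex_of_real t)) has_vector_derivative s * exp (s * of_real t)) (at t within A)"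
  by (auto intro!: derivative_eq_intros has_vector_derivative_real_field)

lemma modal_pos_deriv: "(modal_pos s1 s2 has_vector_derivative modal_vel s1 s2 t) (at t within A)"
proof (cases "s1 = s2")
  case True
  have *: "modal_pos s1 s2 = (\<lambda>t. of_real t * exp (s1 * of_real t))"
    using True by (simp add: modal_pos_def fun_eq_iff)
  show ?thesis unfolding * modal_vel_def using True
    by (auto intro!: derivative_eq_intros has_vector_derivative_exp_of_real simp: algebra_simps)
next
  case False
  have *: "modal_pos s1 s2 = (\<lambda>t. (exp (s1 * of_real t) - exp (s2 * of_real t)) / (s1 - s2))"
    using False by (simp add: modal_pos_def fun_eq_iff)
  show ?thesis unfolding * modal_vel_def using False
    by (auto intro!: derivative_eq_intros has_vector_derivative_exp_of_real simp: divide_simps)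
      (auto simp: algebra_simps)
qed

lemma modal_vel_deriv:
  "(modal_vel s1 s2 has_vector_derivative (s1 + s2) * modal_vel s1 s2 t - s1 * s2 * modal_pos s1 s2 t) (at t within A)"
proof -
  have *: "modal_vel s1 s2 = (\<lambda>t. exp (s1 * of_real t) + s2 * modal_pos s1 s2 t)"
    by (simp add: modal_vel_def fun_eq_iff)
  have "((\<lambda>t. exp (s1 * of_real t) + s2 * modal_pos s1 s2 t) has_vector_derivative
      s1 * exp (s1 * of_real t) + s2 * modal_vel s1 s2 t) (at t within A)"
    by (intro derivative_intros has_vector_derivative_exp_of_real modal_pos_deriv)
  then show ?thesis unfolding *[symmetric] by (simp add: modal_vel_def algebra_simps)
qed

lemma modal_pos_vel_continuous: "continuous_on A (modal_pos s1 s2)" "continuous_on A (modal_vel s1 s2)"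
  using modal_pos_deriv modal_vel_deriv
  by (auto intro!: continuous_on_vector_derivative)

text \<open>Any rate \<open>\<sigma>\<close> strictly above both real parts suffices: the gap
  absorbs the factor \<open>t\<close> that a double root produces.\<close>

lemma modal_pos_vel_bound:
  assumes "Re s1 < \<sigma>" "Re s2 < \<sigma>"
  obtains K where "\<And>t. t \<ge> 0 \<Longrightarrow> norm (modal_pos s1 s2 t) \<le> K * exp (\<sigma> * t)"
    "\<And>t. t \<ge> 0 \<Longrightarrow> norm (modal_vel s1 s2 t) \<le> K * exp (\<sigma> * t)"
proof -
  have e: "norm (exp (s * complex_of_real t)) \<le> exp (\<sigma> * t)" if "Re s < \<sigma>" "t \<ge> 0" for s t
    using that by (simp add: mult_right_mono)
  have "\<exists>K. \<forall>t\<ge>0. norm (modal_pos s1 s2 t) \<le> K * exp (\<sigma> * t)"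
  proof (cases "s1 = s2")
    case True
    define d where "d = \<sigma> - Re s1"
    have d: "d > 0" using assms by (simp add: d_def)
    have "norm (modal_pos s1 s2 t) \<le> (1 / d) * exp (\<sigma> * t)" if "t \<ge> 0" for t
    proof -
      have "t * d \<le> exp (d * t)" using exp_ge_add_one_self[of "d * t"] by (simp add: mult.commute del: exp_ge_add_one_self)
      then have "t * d * exp (Re s1 * t) \<le> exp (d * t) * exp (Re s1 * t)"
        by (rule mult_right_mono) simp
      also have "\<dots> = exp (\<sigma> * t)" by (simp add: d_def flip: exp_add) (simp add: algebra_simps)
      finally show ?thesis using True d that
        by (simp add: modal_pos_def norm_mult field_simps)
    qed
    then show ?thesis by blast
  next
    case False
    have "norm (modal_pos s1 s2 t) \<le> (2 / norm (s1 - s2)) * exp (\<sigma> * t)" if "t \<ge> 0" for t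
    proof -
      have "norm (exp (s1 * complex_of_real t) - exp (s2 * complex_of_real t)) \<le> 2 * exp (\<sigma> * t)"
        using norm_triangle_ineq4[of "exp (s1 * complex_of_real t)" "exp (s2 * complex_of_real t)"]
          e[OF assms(1) that] e[OF assms(2) that] by linarith
      then show ?thesis using False by (simp add: modal_pos_def norm_divide divide_right_mono)
    qed
    then show ?thesis by blast
  qed
  then obtain K where K: "\<And>t. t \<ge> 0 \<Longrightarrow> norm (modal_pos s1 s2 t) \<le> K * exp (\<sigma> * t)" by blast
  define K' where "K' = max K (1 + norm s2 * K)"
  have "norm (modal_vel s1 s2 t) \<le> K' * exp (\<sigma> * t)" if "t \<ge> 0" for t
  proof -
    have "norm (modal_vel s1 s2 t) \<le> norm (exp (s1 * complex_of_real t)) + norm (s2 * modal_pos s1 s2 t)"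
      unfolding modal_vel_def by (rule norm_triangle_ineq)
    also have "\<dots> \<le> exp (\<sigma> * t) + norm s2 * (K * exp (\<sigma> * t))"
      unfolding norm_mult[of s2] by (intro add_mono e assms that mult_left_mono K norm_ge_zero)
    also have "\<dots> = (1 + norm s2 * K) * exp (\<sigma> * t)" by (simp add: algebra_simps)
    also have "\<dots> \<le> K' * exp (\<sigma> * t)" unfolding K'_def by (intro mult_right_mono) auto
    finally show ?thesis .
  qed
  moreover have "norm (modal_pos s1 s2 t) \<le> K' * exp (\<sigma> * t)" if "t \<ge> 0" for t
    using K[OF that] by (rule order_trans) (auto simp: K'_def intro!: mult_right_mono)
  ultimately show thesis using that by blast
qed

text \<open>With \<open>h\<close> the position and \<open>g\<close> the velocity response, the
  functions \<open>exp (- s t) (A h + B g)\<close> are closed under differentiation. Antiderivatives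
  of both integrands are sought in this form, which treats distinct and double roots alike; the
  integral is then \<open>- B\<close>, because \<open>h(0) = 0\<close> and
  \<open>g(0) = 1\<close>.\<close>

lemma modal_pos_vel_laplace:
  assumes \<sigma>: "Re s1 < \<sigma>" "Re s2 < \<sigma>" and s: "Re s > \<sigma>"
  shows "set_integrable lborel {0..} (\<lambda>t. exp (- s * complex_of_real t) * modal_pos s1 s2 t)" (is ?A)
    "(LINT t:{0..}|lborel. exp (- s * complex_of_real t) * modal_pos s1 s2 t)
       = 1 / (s\<^sup>2 - (s1 + s2) * s + s1 * s2)" (is ?B)
    "set_integrable lborel {0..} (\<lambda>t. exp (- s * complex_of_real t) * modal_vel s1 s2 t)" (is ?A')
    "(LINT t:{0..}|lborel. exp (- s * complex_of_real t) * modal_vel s1 s2 t)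
       = s / (s\<^sup>2 - (s1 + s2) * s + s1 * s2)" (is ?B')
proof -
  obtain K where K: "\<And>t. t \<ge> 0 \<Longrightarrow> norm (modal_pos s1 s2 t) \<le> K * exp (\<sigma> * t)"
    "\<And>t. t \<ge> 0 \<Longrightarrow> norm (modal_vel s1 s2 t) \<le> K * exp (\<sigma> * t)"
    using modal_pos_vel_bound[OF \<sigma>] by blast
  define e where "e = Re s - \<sigma>"
  have e: "e > 0" using s by (simp add: e_def)
  have bound: "norm (exp (- s * complex_of_real t) * f) \<le> K * exp (- e * t)"
    if "norm f \<le> K * exp (\<sigma> * t)" for f t
  proof -
    have "norm (exp (- s * complex_of_real t) * f) \<le> exp (- (Re s * t)) * (K * exp (\<sigma> * t))"
      using that by (simp add: norm_mult mult_left_mono)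
    also have "\<dots> = K * exp (- e * t)"
      by (simp add: e_def mult_ac flip: exp_add) (simp add: algebra_simps)
    finally show ?thesis .
  qed
  have cont: "continuous_on {0..} (\<lambda>t. exp (- s * complex_of_real t) * modal_pos s1 s2 t)"
    "continuous_on {0..} (\<lambda>t. exp (- s * complex_of_real t) * modal_vel s1 s2 t)"
    by (intro continuous_intros modal_pos_vel_continuous)+
  show int: ?A ?A'
    by (rule set_integrable_exp_decay[OF _ e]; use cont bound K in auto)+
  have l0: "((\<lambda>t. K * exp (- e * t)) \<longlongrightarrow> 0) at_top" using e by real_asymp
  have lim: "((\<lambda>t. exp (- s * complex_of_real t) * modal_pos s1 s2 t) \<longlongrightarrow> 0) at_top"
     "((\<lambda>t. exp (- s * complex_of_real t) * modal_vel s1 s2 t) \<longlongrightarrow> 0) at_top"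
    by (rule Lim_null_comparison[OF eventually_mono[OF eventually_ge_at_top[of 0]] l0],
        rule bound, rule K, assumption)+
  \<comment> \<open>Up to sign, the determinant of the linear system for \<open>A\<close> and
    \<open>B\<close>; it is nonzero because \<open>s\<close> lies to the right of both
    roots.\<close>
  define D where "D = s\<^sup>2 - (s1 + s2) * s + s1 * s2"
  have D': "D = (s - s1) * (s - s2)" by (simp add: D_def power2_eq_square algebra_simps)
  have "s \<noteq> s1" "s \<noteq> s2" using \<sigma> s by auto
  then have D: "D \<noteq> 0" by (simp add: D')
  have de: "((\<lambda>t. exp (- s * complex_of_real t)) has_vector_derivative (- s) * exp (- s * complex_of_real t)) (at t)" for t
    by (rule has_vector_derivative_exp_of_real)
  let ?P = "\<lambda>A B t. exp (- s * complex_of_real t) * (A * modal_pos s1 s2 t + B * modal_vel s1 s2 t)"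
  have dP: "(?P A B has_vector_derivative
     exp (- s * complex_of_real t) * ((A * modal_vel s1 s2 t + B * ((s1 + s2) * modal_vel s1 s2 t - s1 * s2 * modal_pos s1 s2 t)))
     + ((- s) * exp (- s * complex_of_real t)) * (A * modal_pos s1 s2 t + B * modal_vel s1 s2 t)) (at t)" for A B t
    by (intro has_vector_derivative_mult de has_vector_derivative_add
         has_vector_derivative_mult_right modal_pos_deriv modal_vel_deriv)
  have limP: "(?P A B \<longlongrightarrow> 0) at_top" for A B
  proof -
    have "((\<lambda>t. A * (exp (- s * complex_of_real t) * modal_pos s1 s2 t)
       + B * (exp (- s * complex_of_real t) * modal_vel s1 s2 t)) \<longlongrightarrow> A * 0 + B * 0) at_top"
      by (intro tendsto_intros lim)
    then show ?thesis by (simp add: algebra_simps)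
  qed
  have alg: "E * ((A * g + B * ((s1 + s2) * g - s1 * s2 * h))) + ((- s) * E) * (A * h + B * g)
      = E * (p * h + q * g)"
    if "A + B * (s1 + s2) - s * B = q" "- B * (s1 * s2) - s * A = p" for p q h g E A B :: complex
    unfolding that[symmetric] by (simp add: algebra_simps)
  show ?B
  proof -
    \<comment> \<open>\<open>A\<close> removes the velocity coefficient, after which the position
      coefficient is \<open>- B * D\<close>.\<close>
    define B where "B = - 1 / D"
    define A where "A = (s - (s1 + s2)) * B"
    have 1: "A + B * (s1 + s2) - s * B = 0" by (simp add: A_def algebra_simps)
    have "- B * (s1 * s2) - s * A = - B * D" by (simp add: A_def D_def algebra_simps power2_eq_square)
    then have 2: "- B * (s1 * s2) - s * A = 1" using D by (simp add: B_def)
    have "(?P A B has_vector_derivative exp (- s * complex_of_real t) * modal_pos s1 s2 t) (at t)" for t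
      using dP[of A B t] unfolding alg[OF 1 2] by simp
    from set_integral_FTC_atLeast[OF this cont(1) int(1) limP]
    show ?thesis by (simp add: B_def D_def)
  qed
  show ?B'
  proof -
    \<comment> \<open>Here \<open>A\<close> makes the velocity coefficient 1, and \<open>B\<close>
      cancels the remaining position coefficient \<open>- B * D - s\<close>.\<close>
    define B where "B = - s / D"
    define A where "A = 1 + (s - (s1 + s2)) * B"
    have 1: "A + B * (s1 + s2) - s * B = 1" by (simp add: A_def algebra_simps)
    have "- B * (s1 * s2) - s * A = - B * D - s" by (simp add: A_def D_def algebra_simps power2_eq_square)
    then have 2: "- B * (s1 * s2) - s * A = 0" using D by (simp add: B_def)
    have "(?P A B has_vector_derivative exp (- s * complex_of_real t) * modal_vel s1 s2 t) (at t)" for t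
      using dP[of A B t] unfolding alg[OF 1 2] by simp
    from set_integral_FTC_atLeast[OF this cont(2) int(2) limP]
    show ?thesis by (simp add: B_def D_def)
  qed
qed

section \<open>Square integrability and stability\<close>

text \<open>Otherwise the indicator of some \<open>{T..}\<close> would be integrable, although the
  subintervals \<open>{T..T + n}\<close> give that half line infinite measure.\<close>

lemma not_set_integrable_bounded_below:
  fixes f :: "real \<Rightarrow> complex"
  assumes "\<delta> > 0" and ev: "\<forall>\<^sub>F t in at_top. norm (f t) \<ge> \<delta>"
  shows "\<not> set_integrable lborel {0..} f"
proof
  assume int: "set_integrable lborel {0..} f"
  obtain T where T: "T \<ge> 0" "\<And>t. t \<ge> T \<Longrightarrow> norm (f t) \<ge> \<delta>"
    using ev unfolding eventually_at_top_linorder by (metis linorder_linear order_trans)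
  have "set_integrable lborel {T..} f"
    using set_integrable_subset[OF int, of "{T..}"] T(1) by auto
  then have "integrable lborel (\<lambda>t. indicat_real {T..} t *\<^sub>R (\<delta>))"
    unfolding set_integrable_def
    by (rule Bochner_Integration.integrable_bound) (use T(2) \<open>\<delta> > 0\<close> in \<open>auto simp: indicator_def\<close>)
  then have "integrable lborel (\<lambda>t. inverse \<delta> * (indicat_real {T..} t * \<delta>))"
    by (intro integrable_mult_right) simp
  then have "integrable lborel (indicat_real {T..})"
    using \<open>\<delta> > 0\<close> by (simp add: mult.commute)
  then have "emeasure lborel {T..} < \<infinity>"
    by (subst (asm) integrable_indicator_iff) auto
  moreover have "emeasure lborel {T..T + real n} \<le> emeasure lborel {T..}" for n
    by (rule emeasure_mono) auto
  then have "ennreal (real n) \<le> emeasure lborel {T..}" for n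
    by simp
  ultimately show False
    by (metis ennreal_of_nat_eq_real_of_nat ennreal_Ex_less_of_nat infinity_ennreal_def linorder_not_less)
qed

text \<open>The \<open>s2\<close> term dies out while the \<open>s1\<close> term keeps modulus at
  least \<open>norm A\<close>, so \<open>norm (f t)\<close> eventually stays above
  \<open>norm A / 2\<close>.\<close>

lemma exp_combination_not_L2:
  fixes A B s1 s2 :: complex
  assumes A: "A \<noteq> 0" and s: "Re s1 \<ge> 0" "Re s2 < 0"
  defines "f \<equiv> \<lambda>t. A * exp (s1 * complex_of_real t) + B * exp (s2 * complex_of_real t)"
  shows "\<not> set_integrable lborel {0..} (\<lambda>t. cnj (f t) * f t)"
proof (rule not_set_integrable_bounded_below)
  show "(norm A / 2)\<^sup>2 > 0" using A by simp
  have "((\<lambda>t. norm B * exp (Re s2 * t)) \<longlongrightarrow> 0) at_top" using s(2) by real_asymp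
  then have "\<forall>\<^sub>F t in at_top. norm B * exp (Re s2 * t) < norm A / 2"
    by (rule order_tendstoD) (use A in simp)
  then show "\<forall>\<^sub>F t in at_top. (norm A / 2)\<^sup>2 \<le> norm (cnj (f t) * f t)"
    using eventually_ge_at_top[of 0]
  proof eventually_elim
    case (elim t)
    have "norm A * 1 \<le> norm A * exp (Re s1 * t)"
      by (intro mult_left_mono) (use s elim in auto)
    moreover have "norm (A * exp (s1 * complex_of_real t)) - norm (B * exp (s2 * complex_of_real t)) \<le> norm (f t)"
      unfolding f_def by (metis norm_diff_ineq)
    ultimately have "norm A / 2 \<le> norm (f t)"
      using elim by (simp add: norm_mult)
    then have "(norm A / 2)\<^sup>2 \<le> (norm (f t))\<^sup>2" by (intro power_mono) auto
    then show ?case by (simp add: norm_mult power2_eq_square)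
  qed
qed

text \<open>The negative sum makes at least one root stable and settles a double root at once. If
  the other of two distinct roots, say \<open>s1\<close>, were not stable, its exponential would
  enter the output with coefficient \<open>1 / (s1 - s2)\<close> or \<open>s1 / (s1 - s2)\<close>;
  the nonzero product keeps the latter from vanishing.\<close>

lemma modal_output_L2_stable:
  assumes sum: "Re (s1 + s2) < 0" and prod: "s1 * s2 \<noteq> 0"
    and L2: "set_integrable lborel {0..} (\<lambda>t. cnj (modal_output out s1 s2 t) * modal_output out s1 s2 t)"
  shows "Re s1 < 0 \<and> Re s2 < 0"
proof (cases "s1 = s2")
  case False
  have int: "set_integrable lborel {0..} (\<lambda>t. cnj (modal_pos s1 s2 t) * modal_pos s1 s2 t) \<or>
      set_integrable lborel {0..} (\<lambda>t. cnj (modal_vel s1 s2 t) * modal_vel s1 s2 t)"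
    using L2 by (cases out) (simp_all add: modal_output_def)
  \<comment> \<open>Stated for arbitrary roots so that it also applies with \<open>s1\<close> and
    \<open>s2\<close> exchanged; the disjunction stands for the two output kinds.\<close>
  have *: "Re s1 < 0" if "Re s2 < 0" "s1 * s2 \<noteq> 0" "s1 \<noteq> s2" and
     int: "set_integrable lborel {0..} (\<lambda>t. cnj (modal_pos s1 s2 t) * modal_pos s1 s2 t) \<or>
      set_integrable lborel {0..} (\<lambda>t. cnj (modal_vel s1 s2 t) * modal_vel s1 s2 t)" for s1 s2
  proof (rule ccontr)
    assume "\<not> Re s1 < 0"
    then have ge: "Re s1 \<ge> 0" by simp
    have "modal_pos s1 s2 = (\<lambda>t. (1 / (s1 - s2)) * exp (s1 * complex_of_real t)
         + (- 1 / (s1 - s2)) * exp (s2 * complex_of_real t))"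
      using that by (auto simp: modal_pos_def fun_eq_iff divide_simps)
    then have "\<not> set_integrable lborel {0..} (\<lambda>t. cnj (modal_pos s1 s2 t) * modal_pos s1 s2 t)"
      using exp_combination_not_L2[OF _ ge \<open>Re s2 < 0\<close>, of "1 / (s1 - s2)" "- 1 / (s1 - s2)"] that by simp
    moreover have "modal_vel s1 s2 = (\<lambda>t. (s1 / (s1 - s2)) * exp (s1 * complex_of_real t)
         + (- s2 / (s1 - s2)) * exp (s2 * complex_of_real t))"
      using that by (auto simp: modal_pos_def modal_vel_def fun_eq_iff divide_simps) (auto simp: algebra_simps)
    then have "\<not> set_integrable lborel {0..} (\<lambda>t. cnj (modal_vel s1 s2 t) * modal_vel s1 s2 t)"
      using exp_combination_not_L2[OF _ ge \<open>Re s2 < 0\<close>, of "s1 / (s1 - s2)" "- s2 / (s1 - s2)"] that by simp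
    ultimately show False using int by blast
  qed
  show ?thesis
  proof (cases "Re s2 < 0")
    case True
    then show ?thesis using * prod int False by blast
  next
    case no: False
    then have "Re s1 < 0" using sum by simp
    then show ?thesis
      using *[of s1 s2] prod int False by (metis modal_pos_commute modal_vel_commute mult.commute * )
  qed
qed (use sum in simp)

section \<open>Uniqueness of the Laplace transform\<close>

text \<open>A nonzero value persists on an interval to the right of \<open>t\<close>, which stays
  inside \<open>{0..}\<close> even for \<open>t = 0\<close> and has positive measure.\<close>

lemma AE_zero_imp_zero_atLeast:
  fixes f :: "real \<Rightarrow> real"
  assumes cont: "continuous_on {0..} f" and ae: "AE t in lborel. t \<ge> 0 \<longrightarrow> f t = 0" and t: "t \<ge> 0"
  shows "f t = 0"
proof (rule ccontr)
  assume nz: "f t \<noteq> 0"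
  have "(f \<longlongrightarrow> f t) (at t within {0..})"
    using cont t by (auto simp: continuous_on_def)
  then have "\<forall>\<^sub>F u in at t within {0..}. f u \<noteq> 0"
    using nz by (rule tendsto_imp_eventually_ne)
  then obtain d where d: "d > 0" "\<And>u. u \<ge> 0 \<Longrightarrow> u \<noteq> t \<Longrightarrow> dist u t < d \<Longrightarrow> f u \<noteq> 0"
    unfolding eventually_at by auto
  obtain N where N: "N \<in> null_sets lborel" "{u. \<not> (u \<ge> 0 \<longrightarrow> f u = 0)} \<subseteq> N"
    using ae unfolding eventually_ae_filter by auto
  have "{t<..<t+d} \<subseteq> N"
    using N(2) d t by (force simp: dist_real_def)
  then have "emeasure lborel {t<..<t+d} \<le> emeasure lborel N"
    using N(1) by (intro emeasure_mono) auto
  then show False using N(1) d(1) by (simp add: null_sets_def)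
qed

text \<open>If \<open>g\<close> is not null, \<open>\<bar>g\<bar> + g\<close> and \<open>\<bar>g\<bar>\<close> have the same mass, because \<open>g\<close> has integral 0, and after
  normalization they are probability densities with the same characteristic function.\<close>

lemma AE_zero_if_fourier_zero:
  fixes g :: "real \<Rightarrow> real"
  assumes int: "integrable lborel g"
    and zero: "\<And>\<tau>. (LINT t|lborel. iexp (\<tau> * t) * complex_of_real (g t)) = 0"
  shows "AE t in lborel. g t = 0"
proof (cases "(LINT t|lborel. \<bar>g t\<bar>) = 0")
  case True
  then show ?thesis
    using int by (subst (asm) integral_nonneg_eq_0_iff_AE) auto
next
  case False
  have [measurable]: "g \<in> borel_measurable borel" using int by auto
  define c where "c = (LINT t|lborel. \<bar>g t\<bar>)"
  have c: "c > 0" using False Bochner_Integration.integral_nonneg[of lborel "\<lambda>t. \<bar>g t\<bar>"]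
    by (simp add: c_def order_less_le)
  have "complex_of_real (LINT t|lborel. g t) = 0" using zero[of 0] by simp
  then have g0: "(LINT t|lborel. g t) = 0" by simp
  have distr: "real_distribution (density lborel (\<lambda>t. ennreal (p t)))"
    if "\<And>t. p t \<ge> 0" "integrable lborel p" "(LINT t|lborel. p t) = 1" for p :: "real \<Rightarrow> real"
  proof -
    have "emeasure (density lborel (\<lambda>t. ennreal (p t))) (space (density lborel (\<lambda>t. ennreal (p t)))) = 1"
      using that by (simp add: emeasure_density nn_integral_eq_integral)
    then show ?thesis
      unfolding real_distribution_def real_distribution_axioms_def
      by (auto intro: prob_spaceI)
  qed
  let ?p = "\<lambda>t. (\<bar>g t\<bar> + g t) / c" and ?q = "\<lambda>t. \<bar>g t\<bar> / c"
  have intp: "integrable lborel ?p" "integrable lborel ?q" using int by auto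
  have nn: "?p t \<ge> 0" "?q t \<ge> 0" for t using c by auto
  have one: "(LINT t|lborel. ?p t) = 1" "(LINT t|lborel. ?q t) = 1"
    using int g0 c by (simp_all add: c_def[symmetric])
  have "char (density lborel (\<lambda>t. ennreal (?p t))) = char (density lborel (\<lambda>t. ennreal (?q t)))"
  proof
    fix \<tau> :: real
    have ie: "integrable lborel (\<lambda>t. iexp (\<tau> * t) * complex_of_real (f t))"
      if "integrable lborel f" for f :: "real \<Rightarrow> real"
      by (rule Bochner_Integration.integrable_bound[OF that]) (use that in \<open>auto simp: norm_mult\<close>)
    have ch: "char (density lborel (\<lambda>t. ennreal (p t))) \<tau> = (LINT t|lborel. iexp (\<tau> * t) * complex_of_real (p t))"
      if "\<And>t. p t \<ge> 0" "integrable lborel p" for p :: "real \<Rightarrow> real"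
      using that by (subst char_def, subst integral_density) (auto simp: scaleR_conv_of_real mult.commute)
    \<comment> \<open>\<open>?p\<close> and \<open>?q\<close> differ by \<open>g / c\<close>, whose
      Fourier integral vanishes at every frequency.\<close>
    have "(LINT t|lborel. iexp (\<tau> * t) * complex_of_real (?p t))
      = (LINT t|lborel. iexp (\<tau> * t) * complex_of_real (?q t) +
           (1 / c) * (iexp (\<tau> * t) * complex_of_real (g t)))"
      by (intro Bochner_Integration.integral_cong) (auto simp: algebra_simps add_divide_distrib)
    also have "\<dots> = (LINT t|lborel. iexp (\<tau> * t) * complex_of_real (?q t))
        + (LINT t|lborel. (1 / c) * (iexp (\<tau> * t) * complex_of_real (g t)))"
      by (intro Bochner_Integration.integral_add integrable_mult_right ie intp int)
    also have "\<dots> = (LINT t|lborel. iexp (\<tau> * t) * complex_of_real (?q t))"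
      by (simp only: integral_mult_right_zero zero) simp
    finally show "char (density lborel (\<lambda>t. ennreal (?p t))) \<tau> = char (density lborel (\<lambda>t. ennreal (?q t))) \<tau>"
      by (simp only: ch[OF nn(1) intp(1)] ch[OF nn(2) intp(2)])
  qed
  then have "density lborel (\<lambda>t. ennreal (?p t)) = density lborel (\<lambda>t. ennreal (?q t))"
    by (intro Levy_uniqueness distr nn intp one)
  then have "AE t in lborel. ennreal (?p t) = ennreal (?q t)"
    by (intro sigma_finite_measure.density_unique[OF sigma_finite_lborel]) auto
  then show ?thesis
  proof eventually_elim
    case (elim t)
    then have "?p t = ?q t" using nn by (metis ennreal_inj)
    then show ?case using c by simp
  qed
qed

text \<open>On the line \<open>Re s = \<sigma> + 1\<close> the Laplace integral of \<open>f\<close>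
  is the Fourier integral of \<open>exp (- (\<sigma> + 1) t) f(t)\<close> restricted to
  \<open>{0..}\<close>, so Fourier uniqueness applies; continuity then upgrades almost everywhere to
  everywhere.\<close>

lemma laplace_zero_real:
  fixes f :: "real \<Rightarrow> real"
  assumes cont: "continuous_on {0..} f"
    and int: "\<And>s. Re s > \<sigma> \<Longrightarrow> set_integrable lborel {0..} (\<lambda>t. exp (- s * complex_of_real t) * complex_of_real (f t))"
    and zero: "\<And>s. Re s > \<sigma> \<Longrightarrow> (LINT t:{0..}|lborel. exp (- s * complex_of_real t) * complex_of_real (f t)) = 0"
    and t: "t \<ge> 0"
  shows "f t = 0"
proof -
  define g where "g t = indicat_real {0..} t * (exp (- (\<sigma> + 1) * t) * f t)" for t
  have "integrable lborel (\<lambda>t. complex_of_real (g t))"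
    using int[of "of_real (\<sigma> + 1)"]
    by (simp add: set_integrable_def g_def scaleR_conv_of_real exp_of_real[symmetric])
  then have "integrable lborel g" by (simp add: complex_of_real_integrable_eq)
  moreover have "(LINT t|lborel. iexp (\<tau> * t) * complex_of_real (g t)) = 0" for \<tau>
  proof -
    \<comment> \<open>The frequency enters \<open>s\<close> with a minus sign, since the kernels are
      \<open>exp (\<i> \<tau> t)\<close> and \<open>exp (- s t)\<close>.\<close>
    have "(LINT t|lborel. iexp (\<tau> * t) * complex_of_real (g t))
      = (LINT t:{0..}|lborel. exp (- (Complex (\<sigma> + 1) (- \<tau>)) * complex_of_real t) * complex_of_real (f t))"
      unfolding set_lebesgue_integral_def
    proof (intro Bochner_Integration.integral_cong refl)
      fix t :: real
      have "iexp (\<tau> * t) * complex_of_real (exp (- (\<sigma> + 1) * t))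
         = exp (\<i> * (\<tau> * t) + (- (\<sigma> + 1) * t))"
        by (simp only: exp_add of_real_mult exp_of_real[symmetric])
      also have "\<i> * (\<tau> * t) + complex_of_real (- (\<sigma> + 1) * t) = - (Complex (\<sigma> + 1) (- \<tau>)) * complex_of_real t"
        by (simp add: complex_eq_iff algebra_simps)
      finally show "iexp (\<tau> * t) * complex_of_real (g t) =
         indicat_real {0..} t *\<^sub>R (exp (- (Complex (\<sigma> + 1) (- \<tau>)) * complex_of_real t) * complex_of_real (f t))"
        by (simp add: g_def scaleR_conv_of_real mult_ac)
    qed
    also have "\<dots> = 0" by (rule zero) simp
    finally show ?thesis .
  qed
  ultimately have "AE t in lborel. g t = 0" by (rule AE_zero_if_fourier_zero)
  then have "AE t in lborel. t \<ge> 0 \<longrightarrow> f t = 0"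
    by eventually_elim (auto simp: g_def)
  then show ?thesis using AE_zero_imp_zero_atLeast[OF cont _ t] by simp
qed

text \<open>The real case is applied to \<open>Re f\<close> and \<open>Im f\<close>. Conjugation
  maps the half plane \<open>Re s > \<sigma>\<close> to itself, so \<open>cnj f\<close> has zero
  transform as well, and with \<open>f\<close> and \<open>cnj f\<close> so do the two parts.\<close>

lemma laplace_zero:
  fixes f :: "real \<Rightarrow> complex"
  assumes cont: "continuous_on {0..} f"
    and int: "\<And>s. Re s > \<sigma> \<Longrightarrow> set_integrable lborel {0..} (\<lambda>t. exp (- s * complex_of_real t) * f t)"
    and zero: "\<And>s. Re s > \<sigma> \<Longrightarrow> (LINT t:{0..}|lborel. exp (- s * complex_of_real t) * f t) = 0"
    and t: "t \<ge> 0"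
  shows "f t = 0"
proof -
  have cj: "cnj (indicat_real {0..} t *\<^sub>R (exp (- cnj s * complex_of_real t) * f t))
     = indicat_real {0..} t *\<^sub>R (exp (- s * complex_of_real t) * cnj (f t))" for s t
    by (simp add: exp_cnj)
  have int': "set_integrable lborel {0..} (\<lambda>t. exp (- s * complex_of_real t) * cnj (f t))" if "Re s > \<sigma>" for s
    using integrable_cnj[OF int[of "cnj s", unfolded set_integrable_def]] that
    unfolding set_integrable_def cj by simp
  have zero': "(LINT t:{0..}|lborel. exp (- s * complex_of_real t) * cnj (f t)) = 0" if "Re s > \<sigma>" for s
  proof -
    have "(LINT t:{0..}|lborel. exp (- s * complex_of_real t) * cnj (f t))
        = cnj (LINT t:{0..}|lborel. exp (- cnj s * complex_of_real t) * f t)"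
      unfolding set_lebesgue_integral_def Bochner_Integration.integral_cnj[symmetric] cj ..
    then show ?thesis using zero[of "cnj s"] that by simp
  qed
  have re: "exp (- s * complex_of_real t) * complex_of_real (Re (f t))
     = (1/2) * (exp (- s * complex_of_real t) * f t + exp (- s * complex_of_real t) * cnj (f t))" for s t
    using complex_add_cnj[of "f t"] by (simp add: ring_distribs[symmetric])
  have im: "exp (- s * complex_of_real t) * complex_of_real (Im (f t))
     = (- \<i>/2) * (exp (- s * complex_of_real t) * f t - exp (- s * complex_of_real t) * cnj (f t))" for s t
  proof -
    have "complex_of_real (Im (f t)) = (- \<i> / 2) * (f t - cnj (f t))" by (simp add: complex_eq_iff)
    then show ?thesis by (simp only:) (simp add: algebra_simps)
  qed
  have "Re (f t) = 0"
  proof (rule laplace_zero_real[where \<sigma> = \<sigma>, OF _ _ _ t])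
    show "continuous_on {0..} (\<lambda>t. Re (f t))" by (intro continuous_intros cont)
  next
    fix s assume s: "Re s > \<sigma>"
    show "set_integrable lborel {0..} (\<lambda>t. exp (- s * complex_of_real t) * complex_of_real (Re (f t)))"
      unfolding re by (intro set_integrable_mult_right set_integral_add int int' s)
    show "(LINT t:{0..}|lborel. exp (- s * complex_of_real t) * complex_of_real (Re (f t))) = 0"
      unfolding re set_integral_mult_right
      by (subst set_integral_add(2)) (use int int' zero zero' s in auto)
  qed
  moreover have "Im (f t) = 0"
  proof (rule laplace_zero_real[where \<sigma> = \<sigma>, OF _ _ _ t])
    show "continuous_on {0..} (\<lambda>t. Im (f t))" by (intro continuous_intros cont)
  next
    fix s assume s: "Re s > \<sigma>"
    show "set_integrable lborel {0..} (\<lambda>t. exp (- s * complex_of_real t) * complex_of_real (Im (f t)))"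
      unfolding im by (intro set_integrable_mult_right set_integral_diff int int' s)
    show "(LINT t:{0..}|lborel. exp (- s * complex_of_real t) * complex_of_real (Im (f t))) = 0"
      unfolding im set_integral_mult_right
      by (subst set_integral_diff(2)) (use int int' zero zero' s in auto)
  qed
  ultimately show ?thesis by (simp add: complex_eq_iff)
qed

text \<open>Each transform comes with its own abscissa, so the difference is examined to the right
  of the larger one.\<close>

lemma laplace_transform_unique:
  assumes "continuous_on {0..} f" "continuous_on {0..} g"
    and "\<forall>t<0. f t = 0" "\<forall>t<0. g t = 0"
    and "has_laplace_transform f F" "has_laplace_transform g F"
  shows "f = g"
proof
  fix t
  obtain \<sigma>1 where 1: "set_integrable lborel {0..} (\<lambda>t. exp (- s * complex_of_real t) * f t)"
     "(LINT t:{0..}|lborel. exp (- s * complex_of_real t) * f t) = F s" if "Re s > \<sigma>1" for s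
    using assms(5) unfolding has_laplace_transform_def by blast
  obtain \<sigma>2 where 2: "set_integrable lborel {0..} (\<lambda>t. exp (- s * complex_of_real t) * g t)"
     "(LINT t:{0..}|lborel. exp (- s * complex_of_real t) * g t) = F s" if "Re s > \<sigma>2" for s
    using assms(6) unfolding has_laplace_transform_def by blast
  show "f t = g t"
  proof (cases "t < 0")
    case False
    have "f t - g t = 0"
    proof (rule laplace_zero[where \<sigma> = "max \<sigma>1 \<sigma>2" and f = "\<lambda>t. f t - g t"])
      show "continuous_on {0..} (\<lambda>t. f t - g t)" by (intro continuous_intros assms)
      fix s assume s: "Re s > max \<sigma>1 \<sigma>2"
      show "set_integrable lborel {0..} (\<lambda>t. exp (- s * complex_of_real t) * (f t - g t))"
        unfolding right_diff_distrib using s by (intro set_integral_diff 1 2) auto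
      show "(LINT t:{0..}|lborel. exp (- s * complex_of_real t) * (f t - g t)) = 0"
        unfolding right_diff_distrib using s 1 2 by (subst set_integral_diff(2)) auto
    qed (use False in auto)
    then show ?thesis by simp
  qed (use assms in auto)
qed

text \<open>Resolves the definite description in \<open>inverse_laplace\<close>: existence is the
  transform computed for the closed forms, uniqueness is Lerch's theorem.\<close>

lemma inverse_laplace_modal:
  "inverse_laplace (\<lambda>s. output_poly out s / (s\<^sup>2 - (s1 + s2) * s + s1 * s2))
     = (\<lambda>t. if t < 0 then 0 else modal_output out s1 s2 t)" (is "inverse_laplace ?F = ?h")
  unfolding inverse_laplace_def
proof (rule the_equality)
  have "continuous_on {0..} (modal_output out s1 s2)"
    by (cases out) (auto simp: modal_output_def modal_pos_vel_continuous)
  then have 1: "continuous_on {0..} ?h"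
    by (rule continuous_on_eq) auto
  moreover have "has_laplace_transform ?h ?F"
    unfolding has_laplace_transform_def
  \<comment> \<open>The \<open>+ 1\<close> gives an abscissa strictly above both real parts, as the
    growth bound requires.\<close>
  proof (intro exI[of _ "max (Re s1) (Re s2) + 1"] allI impI)
    fix s assume s: "Re s > max (Re s1) (Re s2) + 1"
    have eq: "(\<lambda>t. indicat_real {0..} t *\<^sub>R (exp (- s * complex_of_real t) * ?h t))
      = (\<lambda>t. indicat_real {0..} t *\<^sub>R (exp (- s * complex_of_real t) * modal_output out s1 s2 t))"
      by (auto simp: indicator_def)
    note l = modal_pos_vel_laplace[of s1 "max (Re s1) (Re s2) + 1" s2 s, OF _ _ s]
    show "set_integrable lborel {0..} (\<lambda>t. exp (- s * complex_of_real t) * ?h t) \<and>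
      (LINT t:{0..}|lborel. exp (- s * complex_of_real t) * ?h t) = ?F s"
      unfolding set_integrable_def set_lebesgue_integral_def eq
      unfolding set_integrable_def[symmetric] set_lebesgue_integral_def[symmetric]
      using l by (cases out) (auto simp: modal_output_def output_poly_def)
  qed
  ultimately show *: "continuous_on {0..} ?h \<and> (\<forall>t<0. ?h t = 0) \<and> has_laplace_transform ?h ?F"
    by simp
  show "h = ?h" if "continuous_on {0..} h \<and> (\<forall>t<0. h t = 0) \<and> has_laplace_transform h ?F" for h
    by (rule laplace_transform_unique) (use * that in blast)+
qed

section \<open>Energy integrals of the modal responses\<close>

text \<open>\<open>V\<close> below is a Hermitian form in \<open>(z, z')\<close> for \<open>z'' + p z' + c z = 0\<close>; the two conditions on \<open>X\<close> cancel
  the mixed terms of its derivative.\<close>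

lemma modal_energy:
  fixes s1 s2 X Y Z :: complex
  assumes st: "Re s1 < 0" "Re s2 < 0"
  defines "p \<equiv> - (s1 + s2)" and "c \<equiv> s1 * s2"
  assumes X: "X = cnj c * Y + p * Z" "X = c * Y + cnj p * cnj Z"
  shows "set_integrable lborel {0..} (\<lambda>t. cnj (modal_pos s1 s2 t) * modal_pos s1 s2 t)" (is ?i1)
    and "set_integrable lborel {0..} (\<lambda>t. cnj (modal_vel s1 s2 t) * modal_vel s1 s2 t)" (is ?i2)
    and "(Z * c + cnj Z * cnj c) * (LINT t:{0..}|lborel. cnj (modal_pos s1 s2 t) * modal_pos s1 s2 t)
      + (Y * (p + cnj p) - Z - cnj Z) * (LINT t:{0..}|lborel. cnj (modal_vel s1 s2 t) * modal_vel s1 s2 t) = Y"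
     (is ?eq)
proof -
  \<comment> \<open>Half the larger, negative real part lies strictly between both real parts and 0,
    so products of two responses decay like \<open>exp (2 \<sigma> t)\<close>.\<close>
  define \<sigma> where "\<sigma> = max (Re s1) (Re s2) / 2"
  have \<sigma>: "Re s1 < \<sigma>" "Re s2 < \<sigma>" "\<sigma> < 0" using st by (auto simp: \<sigma>_def max_def)
  obtain K where K: "\<And>t. t \<ge> 0 \<Longrightarrow> norm (modal_pos s1 s2 t) \<le> K * exp (\<sigma> * t)"
    "\<And>t. t \<ge> 0 \<Longrightarrow> norm (modal_vel s1 s2 t) \<le> K * exp (\<sigma> * t)"
    using modal_pos_vel_bound[OF \<sigma>(1,2)] by blast
  define h g where "h = modal_pos s1 s2" and "g = modal_vel s1 s2"
  have bound: "norm (cnj x * y) \<le> K\<^sup>2 * exp (- (- 2 * \<sigma>) * t)"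
    if "norm x \<le> K * exp (\<sigma> * t)" "norm y \<le> K * exp (\<sigma> * t)" for x y :: complex and t
  proof -
    have "norm (cnj x * y) \<le> (K * exp (\<sigma> * t)) * (K * exp (\<sigma> * t))"
      using that order_trans[OF norm_ge_zero that(1)] by (simp add: norm_mult mult_mono)
    also have "\<dots> = K\<^sup>2 * (exp (\<sigma> * t) * exp (\<sigma> * t))" by (simp add: power2_eq_square)
    also have "\<dots> = K\<^sup>2 * exp (- (- 2 * \<sigma>) * t)" by (simp flip: exp_add)
    finally show ?thesis .
  qed
  have cont: "continuous_on {0..} h" "continuous_on {0..} g"
    by (auto simp: h_def g_def modal_pos_vel_continuous)
  have int: "set_integrable lborel {0..} (\<lambda>t. cnj (h t) * h t)"
    "set_integrable lborel {0..} (\<lambda>t. cnj (g t) * g t)"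
    using \<sigma>(3) unfolding h_def g_def
    by (auto intro!: set_integrable_exp_decay[where e = "- 2 * \<sigma>" and K = "K\<^sup>2"]
        continuous_intros modal_pos_vel_continuous bound K simp del: mult_minus_left minus_mult_minus)
  then show ?i1 ?i2 by (auto simp: h_def g_def)
  have l0: "((\<lambda>t. K\<^sup>2 * exp (- (- 2 * \<sigma>) * t)) \<longlongrightarrow> 0) at_top" using \<sigma>(3) by real_asymp
  have lim: "((\<lambda>t. cnj (h t) * h t) \<longlongrightarrow> 0) at_top" "((\<lambda>t. cnj (g t) * g t) \<longlongrightarrow> 0) at_top"
     "((\<lambda>t. cnj (h t) * g t) \<longlongrightarrow> 0) at_top" "((\<lambda>t. cnj (g t) * h t) \<longlongrightarrow> 0) at_top"
    unfolding h_def g_def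
    by (rule Lim_null_comparison[OF eventually_mono[OF eventually_ge_at_top[of 0]] l0],
        rule bound; rule K; assumption)+
  define V where "V t = X * (cnj (h t) * h t) + Y * (cnj (g t) * g t) + Z * (cnj (h t) * g t)
      + cnj Z * (cnj (g t) * h t)" for t
  let ?\<kappa>1 = "Z * c + cnj Z * cnj c" and ?\<kappa>2 = "Y * (p + cnj p) - Z - cnj Z"
  let ?f = "\<lambda>t. - ?\<kappa>1 * (cnj (h t) * h t) - ?\<kappa>2 * (cnj (g t) * g t)"
  have dh: "(h has_vector_derivative g t) (at t)" for t
    unfolding h_def g_def by (rule modal_pos_deriv)
  have dg: "(g has_vector_derivative - p * g t - c * h t) (at t)" for t
    unfolding h_def g_def p_def c_def using modal_vel_deriv[of s1 s2 t UNIV] by (simp add: add.commute)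
  have dV: "(V has_vector_derivative ?f t) (at t)" for t
  proof -
    let ?dg = "- p * g t - c * h t"
    have "(V has_vector_derivative
       X * (cnj (h t) * g t + cnj (g t) * h t) + Y * (cnj (g t) * ?dg + cnj ?dg * g t)
        + Z * (cnj (h t) * ?dg + cnj (g t) * g t) + cnj Z * (cnj (g t) * g t + cnj ?dg * h t)) (at t)"
      unfolding V_def
      by (intro has_vector_derivative_add has_vector_derivative_mult_right has_vector_derivative_mult
           has_vector_derivative_cnj dh dg)
    \<comment> \<open>The mixed terms are collected with the defects of the two conditions on
      \<open>X\<close> as coefficients, so only the two energy densities remain.\<close>
    moreover have "X * (cnj (h t) * g t + cnj (g t) * h t) + Y * (cnj (g t) * ?dg + cnj ?dg * g t)
        + Z * (cnj (h t) * ?dg + cnj (g t) * g t) + cnj Z * (cnj (g t) * g t + cnj ?dg * h t)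
       = ?f t + (X - (cnj c * Y + p * Z)) * (cnj (h t) * g t)
          + (X - (c * Y + cnj p * cnj Z)) * (cnj (g t) * h t)"
      by (simp add: algebra_simps)
    ultimately show ?thesis using X by simp
  qed
  have "(V \<longlongrightarrow> X * 0 + Y * 0 + Z * 0 + cnj Z * 0) at_top"
    unfolding V_def by (intro tendsto_intros lim)
  then have limV: "(V \<longlongrightarrow> 0) at_top" by simp
  have intf: "set_integrable lborel {0..} ?f"
    by (intro set_integral_diff set_integrable_mult_right int)
  have contf: "continuous_on {0..} ?f" by (intro continuous_intros cont)
  have "(LINT t:{0..}|lborel. ?f t) = - V 0"
    by (rule set_integral_FTC_atLeast[OF dV contf intf limV])
  moreover have "V 0 = Y" by (simp add: V_def h_def g_def)
  moreover have "(LINT t:{0..}|lborel. ?f t) =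
     - ?\<kappa>1 * (LINT t:{0..}|lborel. cnj (h t) * h t) - ?\<kappa>2 * (LINT t:{0..}|lborel. cnj (g t) * g t)"
    by (subst set_integral_diff(2)) (simp_all only: set_integral_mult_right set_integrable_mult_right int)
  ultimately show ?eq unfolding h_def g_def by (simp add: algebra_simps)
qed

text \<open>For real \<open>Y\<close>, taking \<open>X\<close> from the first condition turns the
  second into \<open>Im (p Z) = \<beta> Y\<close>, with \<open>p = - (s1 + s2)\<close>. This leaves
  \<open>Re Z\<close> free, which is spent on eliminating one of the two integrals.\<close>

lemma modal_square_integral:
  assumes st: "Re s1 < 0" "Re s2 < 0"
    and p: "- (s1 + s2) = Complex \<phi> \<xi>" and c: "s1 * s2 = Complex \<alpha> \<beta>"
  shows "(LINT t:{0..}|lborel. cnj (modal_output out s1 s2 t) * modal_output out s1 s2 t)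
    = complex_of_real (case out of
               Position \<Rightarrow> \<phi> / (2 * (\<alpha> * \<phi>\<^sup>2 + \<beta> * \<xi> * \<phi> - \<beta>\<^sup>2))
             | Velocity \<Rightarrow> (\<xi> * \<beta> + \<phi> * \<alpha>) / (2 * (\<alpha> * \<phi>\<^sup>2 + \<beta> * \<xi> * \<phi> - \<beta>\<^sup>2)))"
proof -
  define D where "D = \<alpha> * \<phi>\<^sup>2 + \<beta> * \<xi> * \<phi> - \<beta>\<^sup>2"
  have \<phi>: "\<phi> > 0" using p st by (simp add: complex_eq_iff)
  define I J where "I = (LINT t:{0..}|lborel. cnj (modal_pos s1 s2 t) * modal_pos s1 s2 t)"
    and "J = (LINT t:{0..}|lborel. cnj (modal_vel s1 s2 t) * modal_vel s1 s2 t)"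
  \<comment> \<open>\<open>Z1\<close> with \<open>Y = \<phi>\<close> removes the velocity term of the energy identity, \<open>Z2\<close> below with \<open>Y = \<alpha> \<phi> + \<beta> \<xi>\<close> the position term.\<close>
  define Z1 where "Z1 = Complex (\<phi>\<^sup>2) (\<beta> - \<xi> * \<phi>)"
  have I: "complex_of_real (2 * D) * I = complex_of_real \<phi>"
  proof -
    let ?X = "cnj (s1 * s2) * complex_of_real \<phi> + - (s1 + s2) * Z1"
    have "(Z1 * (s1 * s2) + cnj Z1 * cnj (s1 * s2)) * I +
        (complex_of_real \<phi> * (- (s1 + s2) + cnj (- (s1 + s2))) - Z1 - cnj Z1) * J = complex_of_real \<phi>"
      unfolding I_def J_def
      by (rule modal_energy(3)[OF st, of ?X], rule refl)
        (simp only: p c, simp add: Z1_def complex_eq_iff, simp add: algebra_simps power2_eq_square)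
    moreover have "Z1 * (s1 * s2) + cnj Z1 * cnj (s1 * s2) = complex_of_real (2 * D)"
      by (simp only: c) (simp add: Z1_def D_def complex_eq_iff algebra_simps power2_eq_square)
    moreover have "complex_of_real \<phi> * (- (s1 + s2) + cnj (- (s1 + s2))) - Z1 - cnj Z1 = 0"
      by (simp only: p) (simp add: Z1_def complex_eq_iff power2_eq_square)
    ultimately show ?thesis by simp
  qed
  \<comment> \<open>A zero denominator would contradict the identity just proved, because
    \<open>\<phi>\<close> is positive.\<close>
  then have D: "D \<noteq> 0" using \<phi> by auto
  define Y where "Y = \<alpha> * \<phi> + \<beta> * \<xi>"
  \<comment> \<open>\<open>\<phi> * Y - D\<close> equals \<open>\<beta>\<^sup>2\<close>, so
    \<open>Z2\<close> is \<open>\<i> * \<beta> * cnj (s1 * s2)\<close> and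
    \<open>Z2 * (s1 * s2)\<close> is purely imaginary.\<close>
  define Z2 where "Z2 = Complex (\<phi> * Y - D) (\<alpha> * \<beta>)"
  have J: "complex_of_real (2 * D) * J = complex_of_real Y"
  proof -
    let ?X = "cnj (s1 * s2) * complex_of_real Y + - (s1 + s2) * Z2"
    have "(Z2 * (s1 * s2) + cnj Z2 * cnj (s1 * s2)) * I +
        (complex_of_real Y * (- (s1 + s2) + cnj (- (s1 + s2))) - Z2 - cnj Z2) * J = complex_of_real Y"
      unfolding I_def J_def
      by (rule modal_energy(3)[OF st, of ?X], rule refl)
        (simp only: p c, simp add: Z2_def complex_eq_iff, simp add: Y_def D_def algebra_simps power2_eq_square)
    moreover have "Z2 * (s1 * s2) + cnj Z2 * cnj (s1 * s2) = 0"
      by (simp only: c) (simp add: Z2_def D_def Y_def complex_eq_iff algebra_simps power2_eq_square)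
    moreover have "complex_of_real Y * (- (s1 + s2) + cnj (- (s1 + s2))) - Z2 - cnj Z2 = complex_of_real (2 * D)"
      by (simp only: p) (simp add: Z2_def complex_eq_iff)
    ultimately show ?thesis by simp
  qed
  have "I = complex_of_real (\<phi> / (2 * D))" using I D by (simp add: field_simps)
  moreover have "J = complex_of_real ((\<xi> * \<beta> + \<phi> * \<alpha>) / (2 * D))"
    using J D by (simp add: field_simps Y_def)
  ultimately show ?thesis
    unfolding D_def[symmetric] by (cases out) (simp_all add: modal_output_def I_def J_def)
qed

section \<open>Eigenvalues of the Laplacian\<close>

text \<open>The diagonal entry contains \<open>b i i\<close>, which the differences do not see;
  hence the last term, which disappears for graphs without self-loops.\<close>

lemma laplacian_mult_vec:
  assumes "v \<in> carrier_vec n" "i < n"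
  shows "(cmat (laplacian n b) *\<^sub>v v) $ i
     = (\<Sum>j<n. complex_of_real (b i j) * (v $ i - v $ j)) + complex_of_real (b i i) * v $ i"
proof -
  have "(cmat (laplacian n b) *\<^sub>v v) $ i
     = (\<Sum>j<n. complex_of_real (if i = j then (\<Sum>k<n. b i k) else - b i j) * v $ j)"
    using assms by (simp add: laplacian_def scalar_prod_def atLeast0LessThan)
  also have "\<dots> = (\<Sum>j<n. (if i = j then ((\<Sum>k<n. complex_of_real (b i k)) + b i i) * v $ i else 0)
      - complex_of_real (b i j) * v $ j)"
    by (intro sum.cong) (auto simp: algebra_simps)
  also have "\<dots> = ((\<Sum>k<n. complex_of_real (b i k)) + b i i) * v $ i - (\<Sum>j<n. complex_of_real (b i j) * v $ j)"
    using assms(2) by (simp add: sum_subtractf)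
  also have "\<dots> = (\<Sum>j<n. complex_of_real (b i j) * (v $ i - v $ j)) + complex_of_real (b i i) * v $ i"
    by (simp add: algebra_simps sum_distrib_left sum_distrib_right sum_subtractf)
  finally show ?thesis .
qed

text \<open>The equality case of \<open>Re z \<le> norm z\<close>: the bound leaves no room for an
  imaginary part.\<close>

lemma norm_le_Re_eq:
  fixes z :: complex
  assumes "norm z \<le> m" "Re z = m" shows "z = complex_of_real m"
proof -
  have "(Re z)\<^sup>2 + (Im z)\<^sup>2 \<le> m\<^sup>2"
    using power_mono[OF assms(1), of 2] by (simp add: cmod_power2)
  then show ?thesis using assms(2) by (simp add: complex_eq_iff)
qed

text \<open>Maximum principle: along an edge leaving a node where the modulus of the eigenvector is maximal,
  the eigenvector is constant, because after rotation to a positive value all terms of row \<open>i\<close>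
  of \<open>L v = \<kappa> v\<close> have nonnegative real part.\<close>

lemma eigenvector_max_edge:
  assumes graph: "weighted_digraph n E b"
    and v: "v \<in> carrier_vec n" "cmat (laplacian n b) *\<^sub>v v = \<kappa> \<cdot>\<^sub>v v" "Re \<kappa> \<le> 0"
    and i: "i < n" and max: "\<And>j. j < n \<Longrightarrow> norm (v $ j) \<le> norm (v $ i)"
  shows "\<kappa> * v $ i = 0" and "(i, j) \<in> E \<Longrightarrow> v $ j = v $ i"
proof -
  define m where "m = norm (v $ i)"
  have bnn: "b i j \<ge> 0" if "j < n" for j
    using graph i that unfolding weighted_digraph_def by (cases "(i, j) \<in> E") (auto intro: less_imp_le)
  have bii: "b i i = 0" using graph i unfolding weighted_digraph_def irrefl_def by auto
  have row: "(\<Sum>j<n. complex_of_real (b i j) * (v $ i - v $ j)) = \<kappa> * v $ i"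
    using laplacian_mult_vec[OF v(1) i, of b] v i bii by simp
  have "\<kappa> * v $ i = 0 \<and> (\<forall>j. (i, j) \<in> E \<longrightarrow> v $ j = v $ i)"
  proof (cases "v $ i = 0")
    case True
    then have "v $ j = 0" if "j < n" for j using max[OF that] by simp
    with True show ?thesis using graph unfolding weighted_digraph_def by auto
  next
    case False
    \<comment> \<open>Rotation by the inverse phase of \<open>v $ i\<close>: \<open>u i\<close>
      becomes the positive real \<open>m\<close>, and no entry has larger modulus.\<close>
    define u where "u j = cnj (v $ i) * v $ j / m" for j
    have m: "m > 0" using False by (simp add: m_def)
    have uim: "u i = complex_of_real m"
      using m complex_norm_square[of "v $ i"] by (simp add: u_def m_def power2_eq_square field_simps)
    have un: "norm (u j) \<le> m" if "j < n" for j
      using max[OF that] m by (simp add: u_def norm_mult norm_divide m_def[symmetric])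
    have "(\<Sum>j<n. complex_of_real (b i j) * (u i - u j)) = cnj (v $ i) / m * (\<kappa> * v $ i)"
      unfolding row[symmetric] sum_distrib_left by (intro sum.cong) (auto simp: u_def field_simps diff_divide_distrib)
    also have "\<dots> = \<kappa> * u i" by (simp add: u_def mult_ac)
    also have "\<dots> = \<kappa> * complex_of_real m" by (simp only: uim)
    finally have eq: "(\<Sum>j<n. complex_of_real (b i j) * (u i - u j)) = \<kappa> * complex_of_real m" .
    have nn: "b i j * (m - Re (u j)) \<ge> 0" if "j < n" for j
      using bnn[OF that] un[OF that] complex_Re_le_cmod[of "u j"] by (intro mult_nonneg_nonneg) auto
    \<comment> \<open>The real part of the row is a sum of nonnegative terms equal to
      \<open>Re \<kappa> * m \<le> 0\<close>, so every term vanishes.\<close>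
    have "(\<Sum>j<n. b i j * (m - Re (u j))) = Re \<kappa> * m"
      using arg_cong[OF eq, of Re] by (simp add: uim)
    moreover have "Re \<kappa> * m \<le> 0" using v(3) m by (simp add: mult_nonpos_nonneg)
    ultimately have "(\<Sum>j<n. b i j * (m - Re (u j))) = 0"
      using sum_nonneg[of "{..<n}" "\<lambda>j. b i j * (m - Re (u j))"] nn by force
    then have z: "b i j * (m - Re (u j)) = 0" if "j < n" for j
      using nn that by (subst (asm) sum_nonneg_eq_0_iff) auto
    have uj: "u j = u i" if "j < n" "b i j \<noteq> 0" for j
      unfolding uim using z[OF that(1)] that un by (intro norm_le_Re_eq) auto
    have vj: "v $ j = v $ i" if "j < n" "b i j \<noteq> 0" for j
      using uj[OF that] False m by (simp add: u_def)
    have "(\<Sum>j<n. complex_of_real (b i j) * (v $ i - v $ j)) = 0"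
      using vj by (intro sum.neutral ballI) (metis lessThan_iff mult_eq_0_iff of_real_0 right_minus_eq)
    then have "\<kappa> * v $ i = 0" using row by simp
    moreover have "v $ j = v $ i" if "(i, j) \<in> E" for j
    proof (rule vj)
      show "j < n" using that graph unfolding weighted_digraph_def by auto
      then show "b i j \<noteq> 0" using that graph i unfolding weighted_digraph_def by force
    qed
    ultimately show ?thesis by blast
  qed
  then show "\<kappa> * v $ i = 0" "(i, j) \<in> E \<Longrightarrow> v $ j = v $ i" by auto
qed

text \<open>The next node on the path carries the same value, hence again the maximal modulus, and
  the edge step repeats.\<close>

lemma eigenvector_max_reach:
  assumes graph: "weighted_digraph n E b"
    and v: "v \<in> carrier_vec n" "cmat (laplacian n b) *\<^sub>v v = \<kappa> \<cdot>\<^sub>v v" "Re \<kappa> \<le> 0"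
    and i: "i < n" and max: "\<And>j. j < n \<Longrightarrow> norm (v $ j) \<le> norm (v $ i)"
    and r: "(i, r) \<in> E\<^sup>*"
  shows "v $ r = v $ i"
  using r
proof (induction rule: rtrancl_induct)
  case (step j k)
  have "j < n" using step(2) graph unfolding weighted_digraph_def by auto
  then have "v $ k = v $ j"
    by (rule eigenvector_max_edge(2)[OF graph v _ _ step(2)]) (use max step in auto)
  then show ?case using step by simp
qed simp

lemma eigenvector_max_exists:
  fixes v :: "complex vec"
  assumes "n > 0"
  obtains i where "i < n" "\<And>j. j < n \<Longrightarrow> norm (v $ j) \<le> norm (v $ i)"
proof -
  let ?A = "(\<lambda>j. norm (v $ j)) ` {..<n}"
  have "Max ?A \<in> ?A" using assms by (intro Max_in) auto
  then obtain i where "i < n" "norm (v $ i) = Max ?A" by auto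
  then show thesis using that Max_ge[of ?A] by auto
qed

lemma laplacian_mult_ones:
  assumes graph: "weighted_digraph n E b"
  shows "cmat (laplacian n b) *\<^sub>v ones n = 0\<^sub>v n"
proof (rule eq_vecI)
  show "(cmat (laplacian n b) *\<^sub>v ones n) $ i = 0\<^sub>v n $ i" if "i < dim_vec (0\<^sub>v n)" for i
  proof -
    have i: "i < n" using that by simp
    have "b i i = 0" using graph i unfolding weighted_digraph_def irrefl_def by auto
    then show ?thesis using i laplacian_mult_vec[of "ones n" n i b]
      by (auto simp: ones_def intro!: sum.neutral)
  qed
qed (simp add: laplacian_def)

text \<open>An entry of maximal modulus is nonzero, so the maximum principle first forces
  \<open>\<kappa> = 0\<close>. Then the difference \<open>w\<close> of \<open>v\<close> and the
  constant vector with value \<open>v $ r\<close> lies in the kernel and vanishes at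
  \<open>r\<close>; its maximal entry is transported to \<open>r\<close> along a path, so
  \<open>w\<close> is zero.\<close>

lemma laplacian_eigenvector_Re_nonpos:
  assumes graph: "weighted_digraph n E b" and reach: "globally_reachable n E r"
    and v: "v \<in> carrier_vec n" "cmat (laplacian n b) *\<^sub>v v = \<kappa> \<cdot>\<^sub>v v" "Re \<kappa> \<le> 0" "v \<noteq> 0\<^sub>v n"
  shows "v = v $ r \<cdot>\<^sub>v ones n"
proof -
  have r: "r < n" "\<And>i. i < n \<Longrightarrow> (i, r) \<in> E\<^sup>*" using reach unfolding globally_reachable_def by auto
  then have n: "n > 0" by simp
  obtain i where i: "i < n" "\<And>j. j < n \<Longrightarrow> norm (v $ j) \<le> norm (v $ i)"
    using eigenvector_max_exists[OF n] by metis
  have "v $ i \<noteq> 0"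
  proof
    assume "v $ i = 0"
    then have "v $ j = 0" if "j < n" for j using i(2)[OF that] by simp
    then have "v = 0\<^sub>v n" using v(1) by (intro eq_vecI) auto
    then show False using v(4) by simp
  qed
  moreover have "\<kappa> * v $ i = 0" by (rule eigenvector_max_edge(1)[OF graph v(1-3) i])
  ultimately have \<kappa>: "\<kappa> = 0" by simp
  define w where "w = v - v $ r \<cdot>\<^sub>v ones n"
  have on: "ones n \<in> carrier_vec n" by (simp add: ones_def)
  have Lc: "cmat (laplacian n b) \<in> carrier_mat n n" by (simp add: laplacian_def)
  have w: "w \<in> carrier_vec n" unfolding w_def using v(1) by (auto simp: ones_def intro!: minus_carrier_vec)
  have "cmat (laplacian n b) *\<^sub>v w = 0\<^sub>v n"
  proof -
    have "cmat (laplacian n b) *\<^sub>v w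
        = cmat (laplacian n b) *\<^sub>v v - cmat (laplacian n b) *\<^sub>v (v $ r \<cdot>\<^sub>v ones n)"
      unfolding w_def by (rule mult_minus_distrib_mat_vec[OF Lc v(1)]) (simp add: ones_def)
    also have "cmat (laplacian n b) *\<^sub>v (v $ r \<cdot>\<^sub>v ones n) = v $ r \<cdot>\<^sub>v 0\<^sub>v n"
      by (simp only: mult_mat_vec[OF Lc on] laplacian_mult_ones[OF graph])
    finally show ?thesis using v(1) by (auto simp: v(2) \<kappa>)
  qed
  then have Lw: "cmat (laplacian n b) *\<^sub>v w = 0 \<cdot>\<^sub>v w" using w by auto
  obtain k where k: "k < n" "\<And>j. j < n \<Longrightarrow> norm (w $ j) \<le> norm (w $ k)"
    using eigenvector_max_exists[OF n] by metis
  have "w $ r = w $ k"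
    by (rule eigenvector_max_reach[OF graph w Lw _ k]) (use r k in auto)
  moreover have "w $ r = 0" using r(1) v(1) by (simp add: w_def ones_def)
  ultimately have w0: "w $ j = 0" if "j < n" for j using k(2)[OF that] by simp
  show ?thesis
  proof (rule eq_vecI)
    fix j assume "j < dim_vec (v $ r \<cdot>\<^sub>v ones n)"
    then have j: "j < n" by (simp add: ones_def)
    then show "v $ j = (v $ r \<cdot>\<^sub>v ones n) $ j" using w0[OF j] v(1) by (simp add: w_def ones_def)
  qed (use v(1) in \<open>simp add: ones_def\<close>)
qed

text \<open>Otherwise column \<open>k\<close> of \<open>R\<close> would be a multiple of
  \<open>ones n\<close>, as column 0 is. Row \<open>k\<close> of \<open>Rinv\<close> annihilates
  column 0 and hence \<open>ones n\<close>, but its product with column \<open>k\<close> is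
  1.\<close>

lemma laplacian_eigenvalue_Re_pos:
  assumes graph: "weighted_digraph n E b" and reach: "globally_reachable n E r"
    and sim: "similar_mat_wit (cmat (laplacian n b)) (mat_diag n lam) R Rinv"
    and first: "col R 0 = a \<cdot>\<^sub>v ones n" "a \<noteq> 0"
    and k: "k \<in> {1..<n}"
  shows "Re (lam k) > 0"
proof (rule ccontr)
  assume "\<not> Re (lam k) > 0"
  then have re: "Re (lam k) \<le> 0" by simp
  have dim: "dim_row (cmat (laplacian n b)) = n" by (simp add: laplacian_def)
  note S = similar_mat_witD[OF dim[symmetric] sim]
  have kn: "k < n" "0 < n" "k \<noteq> 0" using k by auto
  have Lc: "cmat (laplacian n b) \<in> carrier_mat n n" by (simp add: laplacian_def)
  have ce: "col R k \<in> carrier_vec n" using S kn by simp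
  have "cmat (laplacian n b) * R = R * mat_diag n lam * (Rinv * R)"
    unfolding S(3) using S by (intro assoc_mult_mat[of _ n n _ n _ n]) auto
  then have LR: "cmat (laplacian n b) * R = R * mat_diag n lam" using S by simp
  have "cmat (laplacian n b) *\<^sub>v col R k = col (cmat (laplacian n b) * R) k"
    by (rule col_mult2[symmetric, OF Lc _ kn(1)]) (use S in auto)
  also have "\<dots> = R *\<^sub>v col (mat_diag n lam) k"
    unfolding LR by (rule col_mult2[OF _ _ kn(1)]) (use S in auto)
  also have "\<dots> = lam k \<cdot>\<^sub>v col R k"
    using S kn by (intro eq_vecI) (auto simp: mat_diag_def scalar_prod_def if_distrib[where f = "\<lambda>x. _ * x"] cong: if_cong)
  finally have eig: "cmat (laplacian n b) *\<^sub>v col R k = lam k \<cdot>\<^sub>v col R k" .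
  have one: "row Rinv i \<bullet> col R j = (if i = j then 1 else 0)" if "i < n" "j < n" for i j
  proof -
    have "row Rinv i \<bullet> col R j = (Rinv * R) $$ (i, j)"
      by (subst index_mult_mat(1)) (use S that in auto)
    then show ?thesis unfolding S(2) using that by simp
  qed
  have "col R k \<noteq> 0\<^sub>v n"
  proof
    assume "col R k = 0\<^sub>v n"
    then show False using one[OF kn(1) kn(1)] S kn by simp
  qed
  from laplacian_eigenvector_Re_nonpos[OF graph reach ce eig re this]
  obtain z where z: "col R k = z \<cdot>\<^sub>v ones n" by blast
  have on: "ones n \<in> carrier_vec n" by (simp add: ones_def)
  have rc: "row Rinv i \<in> carrier_vec n" if "i < n" for i using S that by auto
  have "a * (row Rinv k \<bullet> ones n) = 0"
    using one[OF kn(1,2)] kn(3) unfolding first(1) scalar_prod_smult_distrib[OF rc[OF kn(1)] on] by simp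
  then have "row Rinv k \<bullet> ones n = 0" using first(2) by simp
  then show False
    using one[OF kn(1) kn(1)] unfolding z scalar_prod_smult_distrib[OF rc[OF kn(1)] on] by simp
qed

section \<open>The impulse response in modal coordinates\<close>

text \<open>The integrating factor \<open>exp (- s t)\<close> makes the product constant. The
  derivative at 0 is one-sided, because the trajectories may jump there.\<close>

lemma linear_ode_zero:
  fixes f :: "real \<Rightarrow> complex"
  assumes d: "\<And>t. t \<ge> 0 \<Longrightarrow> (f has_vector_derivative s * f t) (at t within {0..})"
    and f0: "f 0 = 0" and t: "t \<ge> 0"
  shows "f t = 0"
proof -
  let ?g = "\<lambda>t. exp (- s * complex_of_real t) * f t"
  have "(?g has_vector_derivative 0) (at u within {0..})" if "u \<in> {0..}" for u
  proof -
    have "(?g has_vector_derivative exp (- s * complex_of_real u) * (s * f u)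
        + (- s * exp (- s * complex_of_real u)) * f u) (at u within {0..})"
      by (intro has_vector_derivative_mult has_vector_derivative_exp_of_real d) (use that in simp)
    then show ?thesis by (simp add: algebra_simps)
  qed
  then obtain c where c: "\<And>u. u \<in> {0..} \<Longrightarrow> ?g u = c"
    using has_vector_derivative_zero_constant[of "{0..}" ?g] by auto
  have "?g t = ?g 0" using c[of t] c[of 0] t by simp
  then show ?thesis using f0 by simp
qed

text \<open>The differences \<open>z'\<close> and \<open>u'\<close> from the closed forms have zero
  initial data, and the operator factors as \<open>(d/dt - s2) (d/dt - s1)\<close>: first
  \<open>u' - s1 z'\<close> vanishes, then \<open>z'\<close>.\<close>

lemma second_order_ode_unique:
  fixes z u :: "real \<Rightarrow> complex"
  assumes dz: "\<And>t. t \<ge> 0 \<Longrightarrow> (z has_vector_derivative u t) (at t within {0..})"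
    and du: "\<And>t. t \<ge> 0 \<Longrightarrow> (u has_vector_derivative (s1 + s2) * u t - s1 * s2 * z t) (at t within {0..})"
    and init: "z 0 = 0" "u 0 = w" and t: "t \<ge> 0"
  shows "z t = w * modal_pos s1 s2 t" "u t = w * modal_vel s1 s2 t"
proof -
  define z' u' where "z' t = z t - w * modal_pos s1 s2 t" and "u' t = u t - w * modal_vel s1 s2 t" for t
  have dz': "(z' has_vector_derivative u' t) (at t within {0..})" if "t \<ge> 0" for t
    unfolding z'_def u'_def
    by (intro has_vector_derivative_diff has_vector_derivative_mult_right modal_pos_deriv dz that)
  have du': "(u' has_vector_derivative (s1 + s2) * u' t - s1 * s2 * z' t) (at t within {0..})" if "t \<ge> 0" for t
  proof -
    have "(u' has_vector_derivative ((s1 + s2) * u t - s1 * s2 * z t)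
        - w * ((s1 + s2) * modal_vel s1 s2 t - s1 * s2 * modal_pos s1 s2 t)) (at t within {0..})"
      unfolding u'_def
      by (intro has_vector_derivative_diff has_vector_derivative_mult_right modal_vel_deriv du that)
    then show ?thesis by (simp add: z'_def u'_def algebra_simps)
  qed
  have g: "u' t - s1 * z' t = 0" if "t \<ge> 0" for t
  proof (rule linear_ode_zero[OF _ _ that, of "\<lambda>t. u' t - s1 * z' t" s2])
    fix t :: real assume "t \<ge> 0"
    then have "((\<lambda>t. u' t - s1 * z' t) has_vector_derivative
       ((s1 + s2) * u' t - s1 * s2 * z' t) - s1 * u' t) (at t within {0..})"
      by (intro has_vector_derivative_diff has_vector_derivative_mult_right dz' du')
    then show "((\<lambda>t. u' t - s1 * z' t) has_vector_derivative s2 * (u' t - s1 * z' t)) (at t within {0..})"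
      by (simp add: algebra_simps)
  qed (use init in \<open>simp add: z'_def u'_def\<close>)
  have z0: "z' t = 0"
  proof (rule linear_ode_zero[OF _ _ t, of z' s1])
    fix t :: real assume "t \<ge> 0"
    then show "(z' has_vector_derivative s1 * z' t) (at t within {0..})"
      using dz'[of t] g[of t] by simp
  qed (use init in \<open>simp add: z'_def\<close>)
  then show "z t = w * modal_pos s1 s2 t" by (simp add: z'_def)
  show "u t = w * modal_vel s1 s2 t" using g[OF t] z0 by (simp add: u'_def)
qed

section \<open>From the impulse to an initial value problem\<close>

lemma set_integral_dirac:
  "(LINT \<tau>:{s<..t}|return borel (0::real). (c::real)) = (if s < 0 \<and> 0 \<le> t then c else 0)"
  unfolding set_lebesgue_integral_def by (subst integral_return) (auto simp: indicator_def)

text \<open>The integrated equation over \<open>(-1,0]\<close> picks up exactly the Dirac mass, as \<open>X\<close> vanishes before time 0.\<close>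

lemma impulse_response_ivp:
  assumes A: "A \<in> carrier_mat m m" and X: "impulse_response A u X" and i: "i < m"
  shows "X 0 $ i = u $ i"
    and "t \<ge> 0 \<Longrightarrow> ((\<lambda>t. X t $ i) has_vector_derivative (A *\<^sub>v X t) $ i) (at t within {0..})"
proof -
  have Xc: "X t \<in> carrier_vec m" for t using X A unfolding impulse_response_def by auto
  have Xneg: "X t = 0\<^sub>v m" if "t < 0" for t using X A that unfolding impulse_response_def by auto
  have hi: "((\<lambda>\<tau>. (A *\<^sub>v X \<tau>) $ i) has_integral
      (X t $ i - X s $ i - (if s < 0 \<and> 0 \<le> t then u $ i else 0))) {s..t}" if "s \<le> t" "i < m" for s t i
    using X A that unfolding impulse_response_def set_integral_dirac by auto
  have X0: "X 0 $ i = u $ i" if i: "i < m" for i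
  proof -
    have "((\<lambda>\<tau>. (A *\<^sub>v X \<tau>) $ i) has_integral (X 0 $ i - u $ i)) {-1..0}"
      using hi[of "-1" 0 i] i Xneg[of "-1"] by simp
    \<comment> \<open>The trajectory vanishes before time 0, so the integrand is nonzero at most at
      the single point 0.\<close>
    moreover have "((\<lambda>\<tau>. (A *\<^sub>v X \<tau>) $ i) has_integral 0) {-1..0}"
      by (rule has_integral_spike_finite[of "{0}" _ _ "\<lambda>_. 0"])
        (use A i Xneg in \<open>auto simp: scalar_prod_def\<close>)
    ultimately show ?thesis by (metis has_integral_unique eq_iff_diff_eq_0)
  qed
  from X0[OF i] show "X 0 $ i = u $ i" .
  have hi0: "((\<lambda>\<tau>. (A *\<^sub>v X \<tau>) $ i) has_integral (X t $ i - u $ i)) {0..t}" if "t \<ge> 0" "i < m" for t i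
    using hi[of 0 t i] that X0 by simp
  have Xint: "X t $ i = u $ i + integral {0..t} (\<lambda>\<tau>. (A *\<^sub>v X \<tau>) $ i)" if "t \<ge> 0" "i < m" for t i
    using integral_unique[OF hi0[OF that]] by simp
  \<comment> \<open>Regularity is bootstrapped: as an indefinite integral \<open>X\<close> is
    continuous, so the integrand is continuous, so \<open>X\<close> is differentiable.\<close>
  have Xcont: "continuous_on {0..T} (\<lambda>t. X t $ i)" if "i < m" for i T
  proof (cases "T \<ge> 0")
    case True
    have "(\<lambda>\<tau>. (A *\<^sub>v X \<tau>) $ i) integrable_on {0..T}"
      using hi0[OF True \<open>i < m\<close>] by blast
    then have "continuous_on {0..T} (\<lambda>t. u $ i + integral {0..t} (\<lambda>\<tau>. (A *\<^sub>v X \<tau>) $ i))"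
      by (intro continuous_intros indefinite_integral_continuous_1)
    then show ?thesis by (rule continuous_on_eq) (use Xint that in auto)
  qed auto
  have AX: "(A *\<^sub>v X t) $ i = (\<Sum>j<m. A $$ (i, j) * X t $ j)" for t
    using A i Xc[of t] by (auto simp: scalar_prod_def atLeast0LessThan)
  have AXcont: "continuous_on {0..T} (\<lambda>t. (A *\<^sub>v X t) $ i)" for T
    unfolding AX by (intro continuous_intros Xcont) auto
  assume t: "t \<ge> 0"
  \<comment> \<open>\<open>{0..t+1}\<close> contains a right neighbourhood of \<open>t\<close>, so
    the derivative within it is the one within \<open>{0..}\<close>.\<close>
  have "((\<lambda>t. integral {0..t} (\<lambda>\<tau>. (A *\<^sub>v X \<tau>) $ i)) has_vector_derivative (A *\<^sub>v X t) $ i)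
      (at t within {0..t+1})"
    by (rule integral_has_vector_derivative[OF AXcont]) (use t in auto)
  then have "((\<lambda>t. u $ i + integral {0..t} (\<lambda>\<tau>. (A *\<^sub>v X \<tau>) $ i)) has_vector_derivative (A *\<^sub>v X t) $ i)
      (at t within {0..t+1})"
    by (auto intro!: derivative_eq_intros)
  then have "((\<lambda>t. X t $ i) has_vector_derivative (A *\<^sub>v X t) $ i) (at t within {0..t+1})"
    by (rule has_vector_derivative_transform[rotated 2]) (use Xint t i in auto)
  moreover have "at t within {0..t+1} = at t within {0..}"
    by (rule at_within_nhd[of _ "{..<t+1}"]) auto
  ultimately show "((\<lambda>t. X t $ i) has_vector_derivative (A *\<^sub>v X t) $ i) (at t within {0..})"
    by simp
qed

lemma double_integrator_ivp:
  fixes x v :: "real \<Rightarrow> real vec"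
  assumes L: "L \<in> carrier_mat n n" and w0: "w0 \<in> carrier_vec n"
    and xv: "\<And>t. x t \<in> carrier_vec n" "\<And>t. v t \<in> carrier_vec n"
    and traj: "impulse_response (system_mat n k\<^sub>p k\<^sub>d \<gamma>\<^sub>p \<gamma>\<^sub>d L) (input_mat n *\<^sub>v w0) (\<lambda>t. x t @\<^sub>v v t)"
    and i: "i < n"
  shows "x 0 $ i = 0" "v 0 $ i = w0 $ i"
    and "t \<ge> 0 \<Longrightarrow> ((\<lambda>t. x t $ i) has_vector_derivative v t $ i) (at t within {0..})"
    and "t \<ge> 0 \<Longrightarrow> ((\<lambda>t. v t $ i) has_vector_derivative
       - k\<^sub>p * x t $ i - \<gamma>\<^sub>p * (L *\<^sub>v x t) $ i - k\<^sub>d * v t $ i - \<gamma>\<^sub>d * (L *\<^sub>v v t) $ i) (at t within {0..})"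
proof -
  let ?A = "system_mat n k\<^sub>p k\<^sub>d \<gamma>\<^sub>p \<gamma>\<^sub>d L"
  have Ac: "?A \<in> carrier_mat (n + n) (n + n)"
    unfolding system_mat_def using L by (intro four_block_carrier_mat) auto
  have AX: "?A *\<^sub>v (x t @\<^sub>v v t) = (0\<^sub>m n n *\<^sub>v x t + 1\<^sub>m n *\<^sub>v v t) @\<^sub>v
      ((- (k\<^sub>p \<cdot>\<^sub>m 1\<^sub>m n) - \<gamma>\<^sub>p \<cdot>\<^sub>m L) *\<^sub>v x t + (- (k\<^sub>d \<cdot>\<^sub>m 1\<^sub>m n) - \<gamma>\<^sub>d \<cdot>\<^sub>m L) *\<^sub>v v t)" for t
    unfolding system_mat_def using L by (intro four_block_mat_mult_vec[of _ n n _ n _ n] xv) auto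
  have block: "((- (k \<cdot>\<^sub>m 1\<^sub>m n) - g \<cdot>\<^sub>m L) *\<^sub>v y) $ i = - k * y $ i - g * (L *\<^sub>v y) $ i"
    if y: "y \<in> carrier_vec n" for k g :: real and y
  proof -
    have "((- (k \<cdot>\<^sub>m 1\<^sub>m n) - g \<cdot>\<^sub>m L) *\<^sub>v y) $ i
       = (\<Sum>j<n. (- k * (if i = j then 1 else 0) - g * L $$ (i, j)) * y $ j)"
      using L y i by (auto simp: scalar_prod_def atLeast0LessThan intro!: sum.cong)
    also have "\<dots> = (\<Sum>j<n. (if i = j then - k * y $ j else 0) - g * (L $$ (i, j) * y $ j))"
      by (intro sum.cong) (auto simp: algebra_simps)
    also have "\<dots> = - k * y $ i - g * (\<Sum>j<n. L $$ (i, j) * y $ j)"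
      using i by (simp add: sum_subtractf sum_distrib_left)
    also have "(\<Sum>j<n. L $$ (i, j) * y $ j) = (L *\<^sub>v y) $ i"
      using L y i by (auto simp: scalar_prod_def atLeast0LessThan)
    finally show ?thesis .
  qed
  have u1: "(input_mat n *\<^sub>v w0) $ i = 0" "(input_mat n *\<^sub>v w0) $ (n + i) = w0 $ i"
    unfolding input_mat_def using w0 i
    by (subst mat_mult_append[of _ n n _ n]; auto)+
  have lo: "(x t @\<^sub>v v t) $ i = x t $ i" "(x t @\<^sub>v v t) $ (n + i) = v t $ i" for t
    using xv[of t] i by auto
  note ivp1 = impulse_response_ivp[OF Ac traj, of i, unfolded lo u1 AX]
    and ivp2 = impulse_response_ivp[OF Ac traj, of "n + i", unfolded lo u1 AX]
  show "x 0 $ i = 0" "v 0 $ i = w0 $ i" using ivp1(1) ivp2(1) i by auto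
  show "((\<lambda>t. x t $ i) has_vector_derivative v t $ i) (at t within {0..})" if "t \<ge> 0"
    using ivp1(2)[OF _ that] i xv[of t] by simp
  show "((\<lambda>t. v t $ i) has_vector_derivative
       - k\<^sub>p * x t $ i - \<gamma>\<^sub>p * (L *\<^sub>v x t) $ i - k\<^sub>d * v t $ i - \<gamma>\<^sub>d * (L *\<^sub>v v t) $ i) (at t within {0..})"
    if "t \<ge> 0"
  proof -
    let ?P = "- (k\<^sub>p \<cdot>\<^sub>m 1\<^sub>m n) - \<gamma>\<^sub>p \<cdot>\<^sub>m L" and ?Q = "- (k\<^sub>d \<cdot>\<^sub>m 1\<^sub>m n) - \<gamma>\<^sub>d \<cdot>\<^sub>m L"
    have "((0\<^sub>m n n *\<^sub>v x t + 1\<^sub>m n *\<^sub>v v t) @\<^sub>v (?P *\<^sub>v x t + ?Q *\<^sub>v v t)) $ (n + i)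
        = (?P *\<^sub>v x t) $ i + (?Q *\<^sub>v v t) $ i"
      using i xv[of t] L by simp
    also have "\<dots> = - k\<^sub>p * x t $ i - \<gamma>\<^sub>p * (L *\<^sub>v x t) $ i - k\<^sub>d * v t $ i - \<gamma>\<^sub>d * (L *\<^sub>v v t) $ i"
      by (simp only: block[OF xv(1)] block[OF xv(2)])
    finally show ?thesis using ivp2(2)[OF _ that] i by simp
  qed
qed

section \<open>Decoupling into modes\<close>

lemma complex_quadratic_roots:
  fixes p c :: complex
  obtains s1 s2 where "s1 + s2 = - p" "s1 * s2 = c"
proof
  define d where "d = csqrt (p\<^sup>2 - 4 * c)"
  have d: "d * d = p * p - 4 * c" using power2_csqrt[of "p\<^sup>2 - 4 * c"] by (simp add: d_def power2_eq_square)
  show "(- p + d) / 2 + (- p - d) / 2 = - p" by (simp add: field_simps)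
  have "(- p + d) / 2 * ((- p - d) / 2) = (p * p - d * d) / 4" by (simp add: field_simps)
  then show "(- p + d) / 2 * ((- p - d) / 2) = c" by (simp add: d)
qed

lemma mat_diag_mult_vec:
  assumes "g \<in> carrier_vec n" "k < n"
  shows "(mat_diag n d *\<^sub>v g) $ k = d k * g $ k"
  using assms by (simp add: mat_diag_def scalar_prod_def if_distrib[where f = "\<lambda>x. x * _"] cong: if_cong)

text \<open>The rows of \<open>Rinv\<close> are left eigenvectors of \<open>L\<close>, so applying
  row \<open>k\<close> to the equations of motion gives a scalar second-order equation with
  characteristic roots \<open>s1\<close> and \<open>s2\<close>.\<close>

lemma modal_coordinates:
  fixes x v :: "real \<Rightarrow> real vec"
  assumes L: "L \<in> carrier_mat n n" and w0: "w0 \<in> carrier_vec n"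
    and xv: "\<And>t. x t \<in> carrier_vec n" "\<And>t. v t \<in> carrier_vec n"
    and traj: "impulse_response (system_mat n k\<^sub>p k\<^sub>d \<gamma>\<^sub>p \<gamma>\<^sub>d L) (input_mat n *\<^sub>v w0) (\<lambda>t. x t @\<^sub>v v t)"
    and sim: "similar_mat_wit (cmat L) (mat_diag n lam) R Rinv"
    and k: "k < n"
    and roots: "s1 + s2 = - (of_real k\<^sub>d + of_real \<gamma>\<^sub>d * lam k)" "s1 * s2 = of_real k\<^sub>p + of_real \<gamma>\<^sub>p * lam k"
    and t: "t \<ge> 0"
  shows "(Rinv *\<^sub>v cvec (x t)) $ k = (Rinv *\<^sub>v cvec w0) $ k * modal_pos s1 s2 t"
    and "(Rinv *\<^sub>v cvec (v t)) $ k = (Rinv *\<^sub>v cvec w0) $ k * modal_vel s1 s2 t"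
proof -
  have "dim_row (cmat L) = n" using L by simp
  note S = similar_mat_witD[OF this[symmetric] sim]
  define r where "r y = (\<Sum>j<n. Rinv $$ (k, j) * complex_of_real (y j))" for y :: "nat \<Rightarrow> real"
  have r: "(Rinv *\<^sub>v cvec y) $ k = r (\<lambda>j. y $ j)" if "y \<in> carrier_vec n" for y
    using S k that by (auto simp: r_def scalar_prod_def atLeast0LessThan)
  have lin: "r (\<lambda>j. - a * f j - b * g j - c * h j - d * e j) = - a * r f - b * r g - c * r h - d * r e"
    for a b c d f g h e
    by (simp add: r_def sum_distrib_left sum_subtractf algebra_simps sum.distrib sum_negf)
  have rL: "r (\<lambda>j. (L *\<^sub>v y) $ j) = lam k * r (\<lambda>j. y $ j)" if y: "y \<in> carrier_vec n" for y
  proof -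
    have cy: "cvec y \<in> carrier_vec n" using y by simp
    have "r (\<lambda>j. (L *\<^sub>v y) $ j) = (Rinv *\<^sub>v cvec (L *\<^sub>v y)) $ k"
      using r[of "L *\<^sub>v y"] L y by simp
    also have "cvec (L *\<^sub>v y) = cmat L *\<^sub>v cvec y"
      using L y by (intro eq_vecI) (auto simp: scalar_prod_def)
    also have "Rinv *\<^sub>v (cmat L *\<^sub>v cvec y) = (Rinv * cmat L) *\<^sub>v cvec y"
      using S cy L by (intro assoc_mult_mat_vec[symmetric, of _ n n _ n]) auto
    also have "Rinv * cmat L = (Rinv * R) * (mat_diag n lam * Rinv)"
    proof -
      have "R * mat_diag n lam * Rinv = R * (mat_diag n lam * Rinv)"
        by (rule assoc_mult_mat) (use S(4-7) in auto)
      then show ?thesis unfolding S(3)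
        by (simp only: assoc_mult_mat[OF S(7) S(6) mult_carrier_mat[OF S(5) S(7)]])
    qed
    also have "\<dots> = mat_diag n lam * Rinv" unfolding S(2) by (rule left_mult_one_mat[OF mult_carrier_mat[OF S(5) S(7)]])
    also have "(mat_diag n lam * Rinv) *\<^sub>v cvec y = mat_diag n lam *\<^sub>v (Rinv *\<^sub>v cvec y)"
      using S cy by (intro assoc_mult_mat_vec[of _ n n _ n]) auto
    also have "\<dots> $ k = lam k * (Rinv *\<^sub>v cvec y) $ k"
      by (rule mat_diag_mult_vec[OF _ k]) (use S(7) cy in simp)
    finally show ?thesis using r[OF y] by simp
  qed
  note ivp = double_integrator_ivp[OF L w0 xv traj]
  have dr: "((\<lambda>t. r (f t)) has_vector_derivative r f') (at t within {0..})"
    if "\<And>j. j < n \<Longrightarrow> ((\<lambda>t. f t j) has_vector_derivative f' j) (at t within {0..})" for f f' t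
    unfolding r_def using that
    by (intro has_vector_derivative_sum has_vector_derivative_mult_right has_vector_derivative_of_real)
      (auto simp: has_real_derivative_iff_has_vector_derivative)
  have dz: "((\<lambda>t. r (\<lambda>j. x t $ j)) has_vector_derivative r (\<lambda>j. v t $ j)) (at t within {0..})"
    if "t \<ge> 0" for t by (intro dr ivp that)
  have du: "((\<lambda>t. r (\<lambda>j. v t $ j)) has_vector_derivative
      (s1 + s2) * r (\<lambda>j. v t $ j) - s1 * s2 * r (\<lambda>j. x t $ j)) (at t within {0..})" if "t \<ge> 0" for t
  proof -
    have "((\<lambda>t. r (\<lambda>j. v t $ j)) has_vector_derivative r (\<lambda>j. - k\<^sub>p * x t $ j - \<gamma>\<^sub>p * (L *\<^sub>v x t) $ j
        - k\<^sub>d * v t $ j - \<gamma>\<^sub>d * (L *\<^sub>v v t) $ j)) (at t within {0..})"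
      by (intro dr ivp that)
    moreover have "r (\<lambda>j. - k\<^sub>p * x t $ j - \<gamma>\<^sub>p * (L *\<^sub>v x t) $ j
        - k\<^sub>d * v t $ j - \<gamma>\<^sub>d * (L *\<^sub>v v t) $ j)
        = (s1 + s2) * r (\<lambda>j. v t $ j) - s1 * s2 * r (\<lambda>j. x t $ j)"
      unfolding lin rL[OF xv(1)] rL[OF xv(2)] roots by (simp add: algebra_simps)
    ultimately show ?thesis by (simp only:)
  qed
  have "r (\<lambda>j. x 0 $ j) = 0" using ivp(1) by (simp add: r_def)
  moreover have "r (\<lambda>j. v 0 $ j) = r (\<lambda>j. w0 $ j)" using ivp(2) by (simp add: r_def)
  ultimately show "(Rinv *\<^sub>v cvec (x t)) $ k = (Rinv *\<^sub>v cvec w0) $ k * modal_pos s1 s2 t"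
    "(Rinv *\<^sub>v cvec (v t)) $ k = (Rinv *\<^sub>v cvec w0) $ k * modal_vel s1 s2 t"
    unfolding r[OF xv(1)] r[OF xv(2)] r[OF w0]
    by (intro second_order_ode_unique[of "\<lambda>t. r (\<lambda>j. x t $ j)" "\<lambda>t. r (\<lambda>j. v t $ j)"] dz du t; simp)+
qed

section \<open>Output energy\<close>

text \<open>Orthonormality says that the matrix with columns \<open>\<theta> i\<close> has its
  adjoint as left inverse; for square matrices this is also a right inverse, which is
  completeness.\<close>

lemma orthonormal_basis_resolution:
  fixes \<theta> :: "nat \<Rightarrow> complex vec"
  assumes c: "\<And>i. i < n \<Longrightarrow> \<theta> i \<in> carrier_vec n"
    and o: "\<And>i j. i < n \<Longrightarrow> j < n \<Longrightarrow> \<theta> i \<bullet>c \<theta> j = (if i = j then 1 else 0)"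
    and a: "a < n" "b < n"
  shows "(\<Sum>i<n. \<theta> i $ a * cnj (\<theta> i $ b)) = (if a = b then 1 else 0)"
proof -
  define T where "T = Matrix.mat n n (\<lambda>(r, i). \<theta> i $ r)"
  define T' where "T' = Matrix.mat n n (\<lambda>(i, r). cnj (\<theta> i $ r))"
  have T: "T \<in> carrier_mat n n" "T' \<in> carrier_mat n n" by (auto simp: T_def T'_def)
  have "T' * T = 1\<^sub>m n"
  proof (rule eq_matI)
    fix i j assume "i < dim_row (1\<^sub>m n)" "j < dim_col (1\<^sub>m n)"
    then have ij: "i < n" "j < n" by auto
    have "(T' * T) $$ (i, j) = (\<Sum>r<n. cnj (\<theta> i $ r) * \<theta> j $ r)"
      using ij by (simp add: T_def T'_def scalar_prod_def atLeast0LessThan)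
    also have "\<dots> = \<theta> j \<bullet>c \<theta> i"
      using c[OF ij(1)] by (simp add: scalar_prod_def atLeast0LessThan mult.commute)
    finally show "(T' * T) $$ (i, j) = 1\<^sub>m n $$ (i, j)" using o[OF ij(2,1)] ij by auto
  qed (use T in auto)
  then have "T * T' = 1\<^sub>m n" using mat_mult_left_right_inverse[OF T(2,1)] by simp
  then have "(T * T') $$ (a, b) = (if a = b then 1 else 0)" using a by simp
  then show ?thesis using a by (simp add: T_def T'_def scalar_prod_def atLeast0LessThan)
qed

text \<open>The resolution of the identity is inserted to the right of \<open>M\<close>, which then
  acts on each \<open>\<theta> i\<close> by its eigenvalue.\<close>

lemma spectral_entries:
  fixes \<theta> :: "nat \<Rightarrow> complex vec" and \<mu> :: "nat \<Rightarrow> real"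
  assumes M: "M \<in> carrier_mat n n"
    and c: "\<And>i. i < n \<Longrightarrow> \<theta> i \<in> carrier_vec n"
    and o: "\<And>i j. i < n \<Longrightarrow> j < n \<Longrightarrow> \<theta> i \<bullet>c \<theta> j = (if i = j then 1 else 0)"
    and e: "\<And>i. i < n \<Longrightarrow> M *\<^sub>v \<theta> i = complex_of_real (\<mu> i) \<cdot>\<^sub>v \<theta> i"
    and a: "a < n" "b < n"
  shows "M $$ (a, b) = (\<Sum>i<n. complex_of_real (\<mu> i) * \<theta> i $ a * cnj (\<theta> i $ b))"
proof -
  have row: "complex_of_real (\<mu> i) * \<theta> i $ a = (\<Sum>r<n. M $$ (a, r) * \<theta> i $ r)" if "i < n" for i
    using arg_cong[OF e[OF that], of "\<lambda>v. v $ a"] c[OF that] M a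
    by (simp add: scalar_prod_def atLeast0LessThan)
  have "M $$ (a, b) = (\<Sum>r<n. M $$ (a, r) * (if r = b then 1 else 0))"
    using a by (simp add: if_distrib[where f = "\<lambda>x. _ * x"] cong: if_cong)
  also have "\<dots> = (\<Sum>r<n. M $$ (a, r) * (\<Sum>i<n. \<theta> i $ r * cnj (\<theta> i $ b)))"
    using orthonormal_basis_resolution[OF c o _ a(2)] by (intro sum.cong) auto
  also have "\<dots> = (\<Sum>i<n. (\<Sum>r<n. M $$ (a, r) * \<theta> i $ r) * cnj (\<theta> i $ b))"
    unfolding sum_distrib_left sum_distrib_right by (subst sum.swap) (simp add: mult_ac)
  also have "\<dots> = (\<Sum>i<n. complex_of_real (\<mu> i) * \<theta> i $ a * cnj (\<theta> i $ b))"
    using row by (intro sum.cong) auto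
  finally show ?thesis .
qed

text \<open>With \<open>y = R z\<close> the energy is a Hermitian form in \<open>z\<close>, and
  expanding \<open>M\<close> in its eigenbasis turns the coefficients into
  \<open>nu\<close>.\<close>

lemma output_energy_modal:
  fixes \<theta> :: "nat \<Rightarrow> complex vec" and \<mu> :: "nat \<Rightarrow> real" and y :: "real vec"
  assumes C: "C \<in> carrier_mat q n" and M: "M = mat_adjoint (cmat C) * cmat C"
    and c: "\<And>i. i < n \<Longrightarrow> \<theta> i \<in> carrier_vec n"
    and o: "\<And>i j. i < n \<Longrightarrow> j < n \<Longrightarrow> \<theta> i \<bullet>c \<theta> j = (if i = j then 1 else 0)"
    and e: "\<And>i. i < n \<Longrightarrow> M *\<^sub>v \<theta> i = complex_of_real (\<mu> i) \<cdot>\<^sub>v \<theta> i"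
    and e0: "\<theta> 0 = complex_of_real (1 / sqrt (real n)) \<cdot>\<^sub>v ones n" "\<mu> 0 = 0"
    and R: "R \<in> carrier_mat n n" "Rinv \<in> carrier_mat n n" "R * Rinv = 1\<^sub>m n"
    and col0: "col R 0 = a \<cdot>\<^sub>v ones n"
    and y: "y \<in> carrier_vec n"
  defines "z \<equiv> \<lambda>k. (Rinv *\<^sub>v cvec y) $ k"
  shows "complex_of_real ((C *\<^sub>v y) \<bullet> (C *\<^sub>v y))
    = (\<Sum>k=1..<n. \<Sum>l=1..<n. cnj (z k) * z l * nu n R \<theta> \<mu> k l)"
proof (cases "n = 0")
  case True
  then show ?thesis using C y by (simp add: scalar_prod_def)
next
  case False
  then have n: "n > 0" by simp
  have Mc: "M \<in> carrier_mat n n" using C by (auto simp: M mat_adjoint_def)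
  have Mab: "M $$ (i, j) = (\<Sum>r<q. complex_of_real (C $$ (r, i)) * complex_of_real (C $$ (r, j)))"
    if "i < n" "j < n" for i j
    using that C by (simp add: M mat_adjoint_def scalar_prod_def atLeast0LessThan)
  have yR: "complex_of_real (y $ i) = (\<Sum>k<n. R $$ (i, k) * z k)" if i: "i < n" for i
  proof -
    have "R *\<^sub>v (Rinv *\<^sub>v cvec y) = (R * Rinv) *\<^sub>v cvec y"
      by (rule assoc_mult_mat_vec[symmetric, OF R(1,2)]) (use y in simp)
    also have "\<dots> = cvec y" using y by (simp add: R(3))
    finally have "complex_of_real (y $ i) = (R *\<^sub>v (Rinv *\<^sub>v cvec y)) $ i" using y i by simp
    then show ?thesis using R i by (simp add: scalar_prod_def atLeast0LessThan z_def)
  qed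
  \<comment> \<open>\<open>y\<close> is real, so one of its two factors may be expanded in
    conjugated form, which makes the sum sesquilinear in \<open>z\<close>.\<close>
  have yR': "complex_of_real (y $ i) = (\<Sum>k<n. cnj (R $$ (i, k)) * cnj (z k))" if i: "i < n" for i
    using arg_cong[OF yR[OF i], of cnj] by simp
  have Cy: "(C *\<^sub>v y) $ r = (\<Sum>i<n. C $$ (r, i) * y $ i)" if "r < q" for r
    using C y that by (auto simp: scalar_prod_def atLeast0LessThan)
  have "complex_of_real ((C *\<^sub>v y) \<bullet> (C *\<^sub>v y)) = (\<Sum>r<q. complex_of_real ((C *\<^sub>v y) $ r) * complex_of_real ((C *\<^sub>v y) $ r))"
    using C by (simp add: scalar_prod_def atLeast0LessThan)
  also have "\<dots> = (\<Sum>r<q. \<Sum>i<n. \<Sum>j<n. (complex_of_real (C $$ (r, i)) * complex_of_real (C $$ (r, j)))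
      * (complex_of_real (y $ i) * complex_of_real (y $ j)))"
    by (intro sum.cong refl) (simp add: Cy sum_product mult_ac)
  also have "\<dots> = (\<Sum>i<n. \<Sum>r<q. \<Sum>j<n. (complex_of_real (C $$ (r, i)) * complex_of_real (C $$ (r, j)))
      * (complex_of_real (y $ i) * complex_of_real (y $ j)))"
    by (rule sum.swap)
  also have "\<dots> = (\<Sum>i<n. \<Sum>j<n. \<Sum>r<q. (complex_of_real (C $$ (r, i)) * complex_of_real (C $$ (r, j)))
      * (complex_of_real (y $ i) * complex_of_real (y $ j)))"
    by (intro sum.cong refl sum.swap)
  also have "\<dots> = (\<Sum>i<n. \<Sum>j<n. M $$ (i, j) * (complex_of_real (y $ i) * complex_of_real (y $ j)))"
    by (intro sum.cong refl) (simp add: Mab sum_distrib_right)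
  also have "\<dots> = (\<Sum>i<n. \<Sum>j<n. \<Sum>k<n. \<Sum>l<n. cnj (z k) * z l * (cnj (R $$ (i, k)) * M $$ (i, j) * R $$ (j, l)))"
  proof (intro sum.cong refl)
    fix i j assume "i \<in> {..<n}" "j \<in> {..<n}"
    then have ij: "i < n" "j < n" by auto
    show "M $$ (i, j) * (complex_of_real (y $ i) * complex_of_real (y $ j))
      = (\<Sum>k<n. \<Sum>l<n. cnj (z k) * z l * (cnj (R $$ (i, k)) * M $$ (i, j) * R $$ (j, l)))"
      unfolding yR'[OF ij(1)] yR[OF ij(2)] sum_product
      unfolding sum_distrib_left
      by (intro sum.cong refl) (simp add: mult_ac)
  qed
  \<comment> \<open>The summation order changes from \<open>i, j, k, l\<close> to
    \<open>k, l, i, j\<close>.\<close>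
  also have "\<dots> = (\<Sum>i<n. \<Sum>k<n. \<Sum>j<n. \<Sum>l<n. cnj (z k) * z l * (cnj (R $$ (i, k)) * M $$ (i, j) * R $$ (j, l)))"
    by (intro sum.cong refl sum.swap)
  also have "\<dots> = (\<Sum>i<n. \<Sum>k<n. \<Sum>l<n. \<Sum>j<n. cnj (z k) * z l * (cnj (R $$ (i, k)) * M $$ (i, j) * R $$ (j, l)))"
    by (intro sum.cong refl sum.swap)
  also have "\<dots> = (\<Sum>k<n. \<Sum>i<n. \<Sum>l<n. \<Sum>j<n. cnj (z k) * z l * (cnj (R $$ (i, k)) * M $$ (i, j) * R $$ (j, l)))"
    by (rule sum.swap)
  also have "\<dots> = (\<Sum>k<n. \<Sum>l<n. \<Sum>i<n. \<Sum>j<n. cnj (z k) * z l * (cnj (R $$ (i, k)) * M $$ (i, j) * R $$ (j, l)))"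
    by (intro sum.cong refl sum.swap)
  also have "\<dots> = (\<Sum>k<n. \<Sum>l<n. cnj (z k) * z l * nu n R \<theta> \<mu> k l)"
  proof (intro sum.cong refl)
    fix k l assume "k \<in> {..<n}" "l \<in> {..<n}"
    then have kl: "k < n" "l < n" by auto
    have "(\<Sum>i<n. \<Sum>j<n. cnj (R $$ (i, k)) * M $$ (i, j) * R $$ (j, l))
       = (\<Sum>i<n. \<Sum>j<n. \<Sum>m<n. (\<theta> m $ i * cnj (R $$ (i, k))) * (R $$ (j, l) * cnj (\<theta> m $ j)) * complex_of_real (\<mu> m))"
      by (intro sum.cong refl)
        (simp add: spectral_entries[OF Mc c o e] sum_distrib_left sum_distrib_right mult_ac)
    also have "\<dots> = (\<Sum>i<n. \<Sum>m<n. \<Sum>j<n. (\<theta> m $ i * cnj (R $$ (i, k))) * (R $$ (j, l) * cnj (\<theta> m $ j)) * complex_of_real (\<mu> m))"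
      by (intro sum.cong refl sum.swap)
    also have "\<dots> = (\<Sum>m<n. \<Sum>i<n. \<Sum>j<n. (\<theta> m $ i * cnj (R $$ (i, k))) * (R $$ (j, l) * cnj (\<theta> m $ j)) * complex_of_real (\<mu> m))"
      by (rule sum.swap)
    also have "\<dots> = (\<Sum>m<n. (\<theta> m \<bullet>c col R k) * (col R l \<bullet>c \<theta> m) * complex_of_real (\<mu> m))"
    proof (intro sum.cong refl)
      fix m assume "m \<in> {..<n}"
      then have m: "m < n" by simp
      have 1: "\<theta> m \<bullet>c col R k = (\<Sum>i<n. \<theta> m $ i * cnj (R $$ (i, k)))"
        using R(1) kl by (simp add: scalar_prod_def atLeast0LessThan)
      have 2: "col R l \<bullet>c \<theta> m = (\<Sum>j<n. R $$ (j, l) * cnj (\<theta> m $ j))"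
        using R(1) kl c[OF m] by (simp add: scalar_prod_def atLeast0LessThan)
      show "(\<Sum>i<n. \<Sum>j<n. (\<theta> m $ i * cnj (R $$ (i, k))) * (R $$ (j, l) * cnj (\<theta> m $ j)) * complex_of_real (\<mu> m))
         = (\<theta> m \<bullet>c col R k) * (col R l \<bullet>c \<theta> m) * complex_of_real (\<mu> m)"
        unfolding 1 2 sum_product unfolding sum_distrib_right ..
    qed
    \<comment> \<open>The sum in \<open>nu\<close> starts at index 1; the term for index 0 carries
      the factor \<open>\<mu> 0 = 0\<close>.\<close>
    also have "\<dots> = nu n R \<theta> \<mu> k l"
      unfolding nu_def lessThan_atLeast0 using n e0(2) by (simp add: sum.atLeast_Suc_lessThan)
    finally show "(\<Sum>i<n. \<Sum>j<n. cnj (z k) * z l * (cnj (R $$ (i, k)) * M $$ (i, j) * R $$ (j, l)))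
       = cnj (z k) * z l * nu n R \<theta> \<mu> k l"
      by (simp only: sum_distrib_left[symmetric])
  qed
  \<comment> \<open>\<open>col R 0\<close> is a multiple of \<open>\<theta> 0\<close> and thus
    orthogonal to all other \<open>\<theta> i\<close>, so every \<open>nu\<close> with an index 0
    vanishes.\<close>
  also have "\<dots> = (\<Sum>k=1..<n. \<Sum>l=1..<n. cnj (z k) * z l * nu n R \<theta> \<mu> k l)"
  proof -
    have ones: "ones n = complex_of_real (sqrt (real n)) \<cdot>\<^sub>v \<theta> 0"
      using n unfolding e0 by (intro eq_vecI) (auto simp: ones_def)
    have t0: "\<theta> 0 \<in> carrier_vec n" using c n by simp
    have z1: "\<theta> i \<bullet>c col R 0 = 0" "col R 0 \<bullet>c \<theta> i = 0" if "i \<in> {1..<n}" for i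
    proof -
      have ti: "\<theta> i \<in> carrier_vec n" using c that by simp
      show "col R 0 \<bullet>c \<theta> i = 0"
        using t0 ti o[of 0 i] that unfolding col0 ones by (simp add: smult_smult_assoc)
      have "\<theta> i \<bullet>c col R 0 = cnj (col R 0 \<bullet>c \<theta> i)"
        using R(1) n ti by (simp add: scalar_prod_def mult.commute)
      then show "\<theta> i \<bullet>c col R 0 = 0" using \<open>col R 0 \<bullet>c \<theta> i = 0\<close> by simp
    qed
    have nu0: "nu n R \<theta> \<mu> 0 l = 0" "nu n R \<theta> \<mu> k 0 = 0" for k l
      unfolding nu_def using z1 by (auto intro!: sum.neutral)
    show ?thesis unfolding lessThan_atLeast0 using n
      by (simp add: sum.atLeast_Suc_lessThan nu0)
  qed
  finally show ?thesis .
qed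

section \<open>Matrix entries for the trace\<close>

lemma index_mult_mat_sum:
  assumes "A \<in> carrier_mat m n" "B \<in> carrier_mat n p" "i < m" "j < p"
  shows "(A * B) $$ (i, j) = (\<Sum>r<n. A $$ (i, r) * B $$ (r, j))"
  using assms by (simp add: scalar_prod_def atLeast0LessThan)

lemma mat_adjoint_index:
  assumes "i < dim_col A" "j < dim_row A"
  shows "mat_adjoint A $$ (i, j) = conjugate (A $$ (j, i))"
  using assms by (simp add: mat_adjoint_def mat_of_rows_index)

text \<open>\<open>w\<close> times its adjoint has rank one, so only \<open>Q w\<close> matters; in
  this form the trace becomes a double sum over modal initial velocities.\<close>

lemma Sigma_Q_entry:
  assumes Q: "Q \<in> carrier_mat m n" and w: "w \<in> carrier_vec n" and ij: "i < m" "j < m"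
  shows "Sigma_Q Q w $$ (i, j) = (Q *\<^sub>v w) $ i * cnj ((Q *\<^sub>v w) $ j)"
proof -
  define W where "W = mat_of_cols n [w]"
  have W: "W \<in> carrier_mat n 1" using mat_of_cols_carrier(1)[of n "[w]"] by (simp add: W_def)
  have Wi: "W $$ (a, 0) = w $ a" if "a < n" for a using that w by (simp add: W_def mat_of_cols_def)
  have WW: "(W * mat_adjoint W) $$ (a, b) = w $ a * cnj (w $ b)" if "a < n" "b < n" for a b
    using that W Wi mat_adjoint_index[of 0 W b] by (auto simp: scalar_prod_def mat_adjoint_def)
  have WWc: "W * mat_adjoint W \<in> carrier_mat n n" using W by (auto simp: mat_adjoint_def)
  have QW: "(Q * (W * mat_adjoint W)) $$ (i, b) = (Q *\<^sub>v w) $ i * cnj (w $ b)" if "b < n" for b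
    unfolding index_mult_mat_sum[OF Q WWc ij(1) that] using that Q ij w
    by (simp add: WW scalar_prod_def atLeast0LessThan sum_distrib_right mult.assoc del: index_mult_mat(1))
  have "Sigma_Q Q w = Q * (W * mat_adjoint W) * mat_adjoint Q"
    using w by (simp add: Sigma_Q_def Let_def W_def)
  also have "\<dots> $$ (i, j) = (\<Sum>b<n. (Q * (W * mat_adjoint W)) $$ (i, b) * mat_adjoint Q $$ (b, j))"
    using Q ij WWc mult_carrier_mat[OF Q WWc]
    by (subst index_mult_mat(1)) (auto simp: scalar_prod_def atLeast0LessThan mat_adjoint_def)
  also have "\<dots> = (\<Sum>b<n. (Q *\<^sub>v w) $ i * cnj (Q $$ (j, b) * w $ b))"
    using Q ij by (intro sum.cong refl) (simp add: QW mat_adjoint_index mult_ac del: index_mult_mat(1))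
  also have "\<dots> = (Q *\<^sub>v w) $ i * cnj ((Q *\<^sub>v w) $ j)"
    using Q ij w by (simp add: scalar_prod_def atLeast0LessThan sum_distrib_left)
  finally show ?thesis .
qed

lemma modal_response_eq:
  assumes "s1 + s2 = - (of_real k\<^sub>d + of_real \<gamma>\<^sub>d * l)" "s1 * s2 = of_real k\<^sub>p + of_real \<gamma>\<^sub>p * l"
  shows "modal_response out k\<^sub>p k\<^sub>d \<gamma>\<^sub>p \<gamma>\<^sub>d l = (\<lambda>t. if t < 0 then 0 else modal_output out s1 s2 t)"
proof -
  have "s\<^sup>2 - (s1 + s2) * s + s1 * s2
      = s\<^sup>2 + (of_real k\<^sub>d + of_real \<gamma>\<^sub>d * l) * s + of_real k\<^sub>p + of_real \<gamma>\<^sub>p * l" for s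
    unfolding assms by (simp add: algebra_simps)
  then show ?thesis
    using inverse_laplace_modal[of out s1 s2] unfolding modal_response_def by (simp only:)
qed

section \<open>The trace formula and the diagonal entries\<close>

theorem theorem4:
  fixes n q :: nat
    and E :: "(nat \<times> nat) set"
    and b :: "nat \<Rightarrow> nat \<Rightarrow> real"
    and k\<^sub>p k\<^sub>d \<gamma>\<^sub>p \<gamma>\<^sub>d :: real
    and L C :: "real mat"
    and R Rinv M :: "complex mat"
    and lam :: "nat \<Rightarrow> complex"
    and \<theta> :: "nat \<Rightarrow> complex vec"
    and \<mu> :: "nat \<Rightarrow> real"
    and a :: complex
    and w0 :: "real vec"
    and x v y :: "real \<Rightarrow> real vec"
    and out :: output_kind
    and h :: "nat \<Rightarrow> real \<Rightarrow> complex"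
    and \<Psi> :: "complex mat"
  assumes graph: "weighted_digraph n E b"
    and reachable: "\<exists>r. globally_reachable n E r"
    and L: "L = laplacian n b"
    and gains_nonneg: "k\<^sub>p \<ge> 0" "k\<^sub>d \<ge> 0" "\<gamma>\<^sub>p \<ge> 0" "\<gamma>\<^sub>d \<ge> 0"
    and gains_nonzero: "k\<^sub>p \<noteq> 0 \<or> \<gamma>\<^sub>p \<noteq> 0" "k\<^sub>d \<noteq> 0 \<or> \<gamma>\<^sub>d \<noteq> 0"
    and C: "C \<in> carrier_mat q n" "C *\<^sub>v ones n = 0\<^sub>v q"
    and diagonalization: "similar_mat_wit (cmat L) (mat_diag n lam) R Rinv"
    and first_mode: "lam 0 = 0" "a \<noteq> 0" "col R 0 = a \<cdot>\<^sub>v ones n"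
    and M: "M = mat_adjoint (cmat C) * cmat C"
    and orthonormal: "\<And>i. i < n \<Longrightarrow> \<theta> i \<in> carrier_vec n"
          "\<And>i j. i < n \<Longrightarrow> j < n \<Longrightarrow> \<theta> i \<bullet>c \<theta> j = (if i = j then 1 else 0)"
    and eigenbasis: "\<And>i. i < n \<Longrightarrow> M *\<^sub>v \<theta> i = complex_of_real (\<mu> i) \<cdot>\<^sub>v \<theta> i"
    and first_eigenvector: "\<theta> 0 = complex_of_real (1 / sqrt (real n)) \<cdot>\<^sub>v ones n" "\<mu> 0 = 0"
    and w0: "w0 \<in> carrier_vec n"
    and trajectory: "\<And>t. x t \<in> carrier_vec n" "\<And>t. v t \<in> carrier_vec n"
          "impulse_response (system_mat n k\<^sub>p k\<^sub>d \<gamma>\<^sub>p \<gamma>\<^sub>d L) (input_mat n *\<^sub>v w0) (\<lambda>t. x t @\<^sub>v v t)"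
    and y: "y = network_output out C x v"
    and h: "\<And>k. h k = modal_response out k\<^sub>p k\<^sub>d \<gamma>\<^sub>p \<gamma>\<^sub>d (lam k)"
    \<comment> \<open>the improper integrals in the entries of \<open>\<Psi>\<close> exist\<close>
    and Psi_exists: "\<And>k l. k \<in> {1..<n} \<Longrightarrow> l \<in> {1..<n} \<Longrightarrow>
          set_integrable lborel {0..} (\<lambda>t. cnj (h k t) * h l t)"
    and Psi: "\<Psi> = Psi n (nu n R \<theta> \<mu>) h"
  shows "set_integrable lborel {0..} (\<lambda>t. y t \<bullet> y t) \<and>
    complex_of_real (LINT t:{0..}|lborel. y t \<bullet> y t)
      = mat_trace (Sigma_Q (drop_first_row Rinv) (cvec w0) * \<Psi>) \<and>
    (\<forall>k\<in>{1..<n}.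
       let \<alpha> = k\<^sub>p + \<gamma>\<^sub>p * Re (lam k); \<phi> = k\<^sub>d + \<gamma>\<^sub>d * Re (lam k);
           \<beta> = \<gamma>\<^sub>p * Im (lam k); \<xi> = \<gamma>\<^sub>d * Im (lam k)
       in \<Psi> $$ (k - 1, k - 1) = nu n R \<theta> \<mu> k k * complex_of_real
            (case out of
               Position \<Rightarrow> \<phi> / (2 * (\<alpha> * \<phi>\<^sup>2 + \<beta> * \<xi> * \<phi> - \<beta>\<^sup>2))
             | Velocity \<Rightarrow> (\<xi> * \<beta> + \<phi> * \<alpha>) / (2 * (\<alpha> * \<phi>\<^sup>2 + \<beta> * \<xi> * \<phi> - \<beta>\<^sup>2))))"
proof -
  obtain r where r: "globally_reachable n E r" using reachable by blast
  then have n: "n > 0" unfolding globally_reachable_def by auto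
  have Lc: "L \<in> carrier_mat n n" by (simp add: L laplacian_def)
  have "dim_row (cmat L) = n" using Lc by simp
  note S = similar_mat_witD[OF this[symmetric] diagonalization]
  define p c where "p k = complex_of_real k\<^sub>d + of_real \<gamma>\<^sub>d * lam k"
    and "c k = complex_of_real k\<^sub>p + of_real \<gamma>\<^sub>p * lam k" for k
  \<comment> \<open>The two roots are packed into a pair so that one choice function yields them for
    all \<open>k\<close>.\<close>
  have "\<exists>s. fst s + snd s = - p k \<and> fst s * snd s = c k" for k
    by (rule complex_quadratic_roots[of "p k" "c k"]) auto
  then obtain s where s: "fst (s k) + snd (s k) = - p k" "fst (s k) * snd (s k) = c k" for k
    by metis
  define s1 s2 where "s1 k = fst (s k)" and "s2 k = snd (s k)" for k
  have roots: "s1 k + s2 k = - p k" "s1 k * s2 k = c k" for k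
    using s by (auto simp: s1_def s2_def)
  have hk: "h k t = modal_output out (s1 k) (s2 k) t" if "t \<ge> 0" for k t
    using that modal_response_eq[OF roots[of k, unfolded p_def c_def], of out] by (simp add: h)
  have hk': "indicat_real {0..} t *\<^sub>R (cnj (h k t) * h l t)
     = indicat_real {0..} t *\<^sub>R (cnj (modal_output out (s1 k) (s2 k) t) * modal_output out (s1 l) (s2 l) t)" for k l t
    using hk by (auto simp: indicator_def)
  define I where "I k l = (LINT t:{0..}|lborel. cnj (h k t) * h l t)" for k l
  define \<omega> where "\<omega> k = (Rinv *\<^sub>v cvec w0) $ k" for k
  have y_energy: "complex_of_real (y t \<bullet> y t)
      = (\<Sum>k=1..<n. \<Sum>l=1..<n. cnj (\<omega> k) * \<omega> l * nu n R \<theta> \<mu> k l * (cnj (h k t) * h l t))"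
    if t: "t \<ge> 0" for t
  proof -
    \<comment> \<open>The state component that the output reads; both output kinds are handled at
      once.\<close>
    define \<eta> where "\<eta> = (case out of Position \<Rightarrow> x t | Velocity \<Rightarrow> v t)"
    have \<eta>: "\<eta> \<in> carrier_vec n" "y t = C *\<^sub>v \<eta>"
      using trajectory(1,2) by (cases out; simp add: \<eta>_def y network_output_def)+
    have z: "(Rinv *\<^sub>v cvec \<eta>) $ k = \<omega> k * h k t" if "k < n" for k
      using modal_coordinates[OF Lc w0 trajectory diagonalization that
          roots[of k, unfolded p_def c_def] t]
      by (cases out) (simp_all add: \<eta>_def \<omega>_def hk[OF t] modal_output_def)
    have "complex_of_real (y t \<bullet> y t) = (\<Sum>k=1..<n. \<Sum>l=1..<n. cnj ((Rinv *\<^sub>v cvec \<eta>) $ k)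
        * (Rinv *\<^sub>v cvec \<eta>) $ l * nu n R \<theta> \<mu> k l)"
      unfolding \<eta>(2)
      by (rule output_energy_modal[where \<theta> = \<theta> and \<mu> = \<mu>, OF C(1) M _ _ _ first_eigenvector S(6,7,1) first_mode(3) \<eta>(1)];
          rule orthonormal eigenbasis; assumption)
    also have "\<dots> = (\<Sum>k=1..<n. \<Sum>l=1..<n. cnj (\<omega> k) * \<omega> l * nu n R \<theta> \<mu> k l * (cnj (h k t) * h l t))"
      by (intro sum.cong refl) (simp add: z mult_ac)
    finally show ?thesis .
  qed
  have int_y: "set_integrable lborel {0..} (\<lambda>t. complex_of_real (y t \<bullet> y t))"
    and LINT_y: "(LINT t:{0..}|lborel. complex_of_real (y t \<bullet> y t))
       = (\<Sum>k=1..<n. \<Sum>l=1..<n. cnj (\<omega> k) * \<omega> l * nu n R \<theta> \<mu> k l * I k l)"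
  proof -
    \<comment> \<open>The modal expansion is proved for \<open>t \<ge> 0\<close> only, so the
      indicator is moved inside the sums; each term is integrable by
      \<open>Psi_exists\<close>.\<close>
    have eq: "indicat_real {0..} t *\<^sub>R complex_of_real (y t \<bullet> y t)
      = (\<Sum>k=1..<n. \<Sum>l=1..<n. cnj (\<omega> k) * \<omega> l * nu n R \<theta> \<mu> k l
          * (indicat_real {0..} t *\<^sub>R (cnj (h k t) * h l t)))" for t
      using y_energy[of t] by (auto simp: indicator_def)
    have int: "integrable lborel (\<lambda>t. indicat_real {0..} t *\<^sub>R (cnj (h k t) * h l t))"
      if "k \<in> {1..<n}" "l \<in> {1..<n}" for k l
      using Psi_exists[OF that] by (simp add: set_integrable_def)
    show "set_integrable lborel {0..} (\<lambda>t. complex_of_real (y t \<bullet> y t))"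
      unfolding set_integrable_def eq
      by (intro Bochner_Integration.integrable_sum integrable_mult_right int)
    show "(LINT t:{0..}|lborel. complex_of_real (y t \<bullet> y t))
       = (\<Sum>k=1..<n. \<Sum>l=1..<n. cnj (\<omega> k) * \<omega> l * nu n R \<theta> \<mu> k l * I k l)"
      unfolding set_lebesgue_integral_def eq I_def
    proof -
      let ?g = "\<lambda>k l t. cnj (\<omega> k) * \<omega> l * nu n R \<theta> \<mu> k l * (indicat_real {0..} t *\<^sub>R (cnj (h k t) * h l t))"
      have "(LINT t|lborel. (\<Sum>k=1..<n. \<Sum>l=1..<n. ?g k l t)) = (\<Sum>k=1..<n. (LINT t|lborel. (\<Sum>l=1..<n. ?g k l t)))"
        by (intro Bochner_Integration.integral_sum Bochner_Integration.integrable_sum integrable_mult_right int)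
      also have "\<dots> = (\<Sum>k=1..<n. \<Sum>l=1..<n. (LINT t|lborel. ?g k l t))"
        by (intro sum.cong refl Bochner_Integration.integral_sum integrable_mult_right int)
      finally show "(LINT t|lborel. (\<Sum>k=1..<n. \<Sum>l=1..<n. ?g k l t))
        = (\<Sum>k=1..<n. \<Sum>l=1..<n. cnj (\<omega> k) * \<omega> l * nu n R \<theta> \<mu> k l
            * (LINT t|lborel. indicat_real {0..} t *\<^sub>R (cnj (h k t) * h l t)))"
        by (simp only: integral_mult_right_zero)
    qed
  qed
  have P: "set_integrable lborel {0..} (\<lambda>t. y t \<bullet> y t)"
    using int_y unfolding set_integrable_def
    by (simp add: scaleR_conv_of_real complex_of_real_integrable_eq flip: of_real_mult)
  have "complex_of_real (LINT t:{0..}|lborel. y t \<bullet> y t)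
      = (\<Sum>k=1..<n. \<Sum>l=1..<n. cnj (\<omega> k) * \<omega> l * nu n R \<theta> \<mu> k l * I k l)"
    unfolding LINT_y[symmetric] by (rule set_integral_complex_of_real[symmetric])
  also have "\<dots> = (\<Sum>k<n-1. \<Sum>l<n-1. cnj (\<omega> (k+1)) * \<omega> (l+1) * \<Psi> $$ (k, l))"
  proof -
    \<comment> \<open>Entry \<open>(k, l)\<close> of \<open>\<Psi>\<close> belongs to the modes
      \<open>k + 1\<close> and \<open>l + 1\<close>.\<close>
    have sh: "(\<Sum>k=1..<n. f k) = (\<Sum>k<n-1. f (k+1))" for f :: "nat \<Rightarrow> complex"
      using sum.shift_bounds_nat_ivl[of f 0 1 "n-1"] n by (simp add: atLeast0LessThan)
    show ?thesis unfolding sh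
      by (intro sum.cong refl) (simp add: Psi Psi_def I_def)
  qed
  also have "\<dots> = mat_trace (Sigma_Q (drop_first_row Rinv) (cvec w0) * \<Psi>)"
  proof -
    let ?Q = "drop_first_row Rinv" and ?S = "Sigma_Q (drop_first_row Rinv) (cvec w0)"
    have Q: "?Q \<in> carrier_mat (n - 1) n" using S(7) by (simp add: drop_first_row_def)
    have cw: "cvec w0 \<in> carrier_vec n" using w0 by simp
    have Sdim: "dim_row ?S = n - 1" "dim_col ?S = n - 1"
      using Q by (auto simp: Sigma_Q_def Let_def mat_adjoint_def)
    have Pdim: "dim_row \<Psi> = n - 1" "dim_col \<Psi> = n - 1" by (auto simp: Psi Psi_def)
    have Qw: "(?Q *\<^sub>v cvec w0) $ i = \<omega> (i + 1)" if "i < n - 1" for i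
      using that S(7) w0 by (auto simp: \<omega>_def drop_first_row_def scalar_prod_def)
    have "mat_trace (?S * \<Psi>) = (\<Sum>i<n-1. \<Sum>j<n-1. ?S $$ (i, j) * \<Psi> $$ (j, i))"
      unfolding mat_trace_def using Sdim Pdim
      by (auto simp: scalar_prod_def atLeast0LessThan intro!: sum.cong)
    also have "\<dots> = (\<Sum>i<n-1. \<Sum>j<n-1. cnj (\<omega> (j+1)) * \<omega> (i+1) * \<Psi> $$ (j, i))"
      by (intro sum.cong refl) (simp add: Sigma_Q_entry[OF Q cw] Qw)
    \<comment> \<open>The trace pairs entry \<open>(i, j)\<close> with entry \<open>(j, i)\<close>,
      so the row index of \<open>\<Psi>\<close> is the inner one until the sums are
      exchanged.\<close>
    also have "\<dots> = (\<Sum>k<n-1. \<Sum>l<n-1. cnj (\<omega> (k+1)) * \<omega> (l+1) * \<Psi> $$ (k, l))"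
      by (rule sum.swap)
    finally show ?thesis by simp
  qed
  finally have trace: "complex_of_real (LINT t:{0..}|lborel. y t \<bullet> y t)
      = mat_trace (Sigma_Q (drop_first_row Rinv) (cvec w0) * \<Psi>)" .
  have diag: "\<Psi> $$ (k - 1, k - 1) = nu n R \<theta> \<mu> k k * complex_of_real
            (case out of
               Position \<Rightarrow> \<phi> / (2 * (\<alpha> * \<phi>\<^sup>2 + \<beta> * \<xi> * \<phi> - \<beta>\<^sup>2))
             | Velocity \<Rightarrow> (\<xi> * \<beta> + \<phi> * \<alpha>) / (2 * (\<alpha> * \<phi>\<^sup>2 + \<beta> * \<xi> * \<phi> - \<beta>\<^sup>2)))"
    if k: "k \<in> {1..<n}" and defs: "\<alpha> = k\<^sub>p + \<gamma>\<^sub>p * Re (lam k)" "\<phi> = k\<^sub>d + \<gamma>\<^sub>d * Re (lam k)"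
      "\<beta> = \<gamma>\<^sub>p * Im (lam k)" "\<xi> = \<gamma>\<^sub>d * Im (lam k)" for k \<alpha> \<beta> \<phi> \<xi>
  proof -
    have lam: "Re (lam k) > 0"
      using laplacian_eigenvalue_Re_pos[OF graph r _ first_mode(3,2) k] diagonalization by (simp add: L)
    \<comment> \<open>One of the two gains is positive and so is \<open>Re (lam k)\<close>, hence at
      least one summand is positive; likewise for \<open>\<alpha>\<close>.\<close>
    have \<phi>: "\<phi> > 0" using gains_nonneg gains_nonzero lam unfolding defs
      by (smt (verit) mult_nonneg_nonneg mult_pos_pos)
    have \<alpha>: "\<alpha> > 0" using gains_nonneg gains_nonzero lam unfolding defs
      by (smt (verit) mult_nonneg_nonneg mult_pos_pos)
    have pk: "p k = Complex \<phi> \<xi>" and ck: "c k = Complex \<alpha> \<beta>"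
      by (simp_all add: p_def c_def defs complex_eq_iff)
    \<comment> \<open>Stability of both poles is drawn from the case \<open>k = l\<close> of
      \<open>Psi_exists\<close>: \<open>\<phi> > 0\<close> makes the sum of the roots have negative
      real part, and \<open>\<alpha> > 0\<close> makes their product nonzero.\<close>
    have L2: "set_integrable lborel {0..}
        (\<lambda>t. cnj (modal_output out (s1 k) (s2 k) t) * modal_output out (s1 k) (s2 k) t)"
      using Psi_exists[OF k k] unfolding set_integrable_def hk' .
    have "Re (s1 k) < 0 \<and> Re (s2 k) < 0"
      by (rule modal_output_L2_stable[OF _ _ L2]) (use \<phi> \<alpha> in \<open>auto simp: roots pk ck complex_eq_iff\<close>)
    then have st: "Re (s1 k) < 0" "Re (s2 k) < 0" by auto
    have "I k k = (LINT t:{0..}|lborel. cnj (modal_output out (s1 k) (s2 k) t) * modal_output out (s1 k) (s2 k) t)"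
      unfolding I_def set_lebesgue_integral_def hk' ..
    also note modal_square_integral[OF st, of \<phi> \<xi> \<alpha> \<beta> out]
    finally have "I k k = complex_of_real (case out of
               Position \<Rightarrow> \<phi> / (2 * (\<alpha> * \<phi>\<^sup>2 + \<beta> * \<xi> * \<phi> - \<beta>\<^sup>2))
             | Velocity \<Rightarrow> (\<xi> * \<beta> + \<phi> * \<alpha>) / (2 * (\<alpha> * \<phi>\<^sup>2 + \<beta> * \<xi> * \<phi> - \<beta>\<^sup>2)))"
      by (simp add: roots pk ck)
    moreover have "\<Psi> $$ (k - 1, k - 1) = nu n R \<theta> \<mu> k k * I k k"
      using k by (cases k) (auto simp: Psi Psi_def I_def)
    ultimately show ?thesis by simp
  qed
  show ?thesis using P trace diag unfolding Let_def by blast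
qed

end
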